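(* Let $A$ be an $H^*$-Galois left $H$-module algebra over a finite dimensional Hopf algebra $H$ and let $E=\operatorname{End}_HA$. Suppose that $V\subset H$ is a subspace stable under the adjoint action of $H$ on itself, regarded as an $H$-module via the adjoint action, and that $V$ generates $H$ as an algebra. Let $\{e_i\}$ and $\{e_i^*\}$ be dual bases for $V$ and $V^*$. Then $E$ is generated as an algebra by the operators $\Psi_\tau$ with $\tau\in D({}^*V)$, where $$\Psi_\tau(a)=\sum_i\tau(e_i^* )\,(e_ia)\qquad\text{for }a\in A.$$
   Context: $k$ is a field; unadorned $\otimes$, $\operatorname{Hom}$, $\operatorname{End}$ are over $k$. $H$ is a finite dimensional Hopf algebra over $k$ with $\Delta h=\sum_{(h)}h'\otimes h''$, counit $\varepsilon$, antipode $S$. Algebras are extensions of $k$ (so $A\neq0$, $k=k1_A\subset A$). A left $H$-module algebra $A$ is $H^*$-Galois if the map $\pi:A\otimes H\to\operatorname{End}A$, $\pi(a\otimes h)(b)=a(hb)$, is bijective; equivalently (known fact) if any one of the maps $\pi'(a\otimes h)(b)=(hb)a$ from $A\otimes H$ to $\operatorname{End}A$, $\gamma(a\otimes b)(h)=a(hb)$, $\gamma'(a\otimes b)(h)=(ha)b$ from $A\otimes A$ to $\operatorname{Hom}(H,A)\cong A\otimes H^*$ is bijective. Then $\dim A<\infty$ and $A^H=k$. $E=\operatorname{End}_HA$ is the algebra of $H$-module endomorphisms of $A$. The adjoint action of $H$ on itself is $h\triangleright g=\sum_{(h)}h'gS(h'')$. For a finite dimensional left $H$-module $V$, the right dual ${}^*V$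 is the dual vector space of $V$ with $H$-action $\langle h\xi,v\rangle=\langle\xi,S^{-1}(h)v\rangle$. $D(W)=\operatorname{Hom}_H(W,A)$ for a finite dimensional left $H$-module $W$; so $\tau\in D({}^*V)$ is an $H$-linear map from the dual space of $V$ (with this action) to $A$. In the formula for $\Psi_\tau$, $e_ia$ denotes the action of $e_i\in V\subset H$ on $a\in A$; these operators belong to $E$. *)

theory Defs
  imports Complex_Main "HOL-Library.Poly_Mapping" "HOL-Library.Function_Algebras"
begin

text \<open>A vector space over a field \<open>'k\<close> is a type of class \<open>ab_group_add\<close> together with a scalar
  multiplication satisfying the library locale \<open>vector_space\<close>.  The class \<open>ring_1\<close> includes
  \<open>0 \<noteq> 1\<close>, so algebras are nonzero.\<close>

locale algebra_over = vector_space scale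
  for scale :: "'k::field \<Rightarrow> 'a::ring_1 \<Rightarrow> 'a" +
  assumes scale_mult_left: "scale c x * y = scale c (x * y)"
    and scale_mult_right: "x * scale c y = scale c (x * y)"

definition fun_scale :: "('k \<Rightarrow> 'b \<Rightarrow> 'b) \<Rightarrow> 'k \<Rightarrow> ('x \<Rightarrow> 'b) \<Rightarrow> ('x \<Rightarrow> 'b)" where
  "fun_scale s c f = (\<lambda>x. s c (f x))"

definition fin_dim :: "('k::field \<Rightarrow> 'b::ab_group_add \<Rightarrow> 'b) \<Rightarrow> bool" where
  "fin_dim s \<longleftrightarrow> (\<exists>B. finite B \<and> module.span s B = UNIV)"

text \<open>The product and the unit are parameters, so that the notion applies both to an algebra type
  (with \<open>(*)\<close> and \<open>1\<close>) and to linear operators (with \<open>(\<circ>)\<close> and \<open>id\<close>).  The subalgebra generated by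
  \<open>X\<close> is \<open>subalgebra s m u hull X\<close>; for a set \<open>X\<close> of linear operators it consists of linear operators
  and is the subalgebra of the endomorphism algebra generated by \<open>X\<close>.\<close>

definition subalgebra ::
  "('k::field \<Rightarrow> 'b::ab_group_add \<Rightarrow> 'b) \<Rightarrow> ('b \<Rightarrow> 'b \<Rightarrow> 'b) \<Rightarrow> 'b \<Rightarrow> 'b set \<Rightarrow> bool" where
  "subalgebra s m u B \<longleftrightarrow> module.subspace s B \<and> u \<in> B \<and> (\<forall>x\<in>B. \<forall>y\<in>B. m x y \<in> B)"

section \<open>Tensor products\<close>

text \<open>\<open>'x \<Rightarrow>\<^sub>0 'k\<close> is the free vector space on \<open>'x\<close>, with scalar multiplication \<open>free_scale\<close>;
  \<open>free_lift s f\<close> is the linear extension of a map \<open>f\<close> defined on the basis \<open>'x\<close>.  The tensor product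
  of two spaces is the quotient of the free space on pairs by the span of the bilinearity
  relations, and similarly for triples.\<close>

definition free_scale :: "'k::field \<Rightarrow> ('x \<Rightarrow>\<^sub>0 'k) \<Rightarrow> ('x \<Rightarrow>\<^sub>0 'k)" where
  "free_scale c x = Poly_Mapping.map ((*) c) x"

definition free_lift ::
  "('k::field \<Rightarrow> 'b::ab_group_add \<Rightarrow> 'b) \<Rightarrow> ('x \<Rightarrow> 'b) \<Rightarrow> ('x \<Rightarrow>\<^sub>0 'k) \<Rightarrow> 'b" where
  "free_lift s f x = (\<Sum>p\<in>Poly_Mapping.keys x. s (Poly_Mapping.lookup x p) (f p))"

abbreviation gen :: "'x \<Rightarrow> ('x \<Rightarrow>\<^sub>0 'k::field)" where
  "gen p \<equiv> Poly_Mapping.single p 1"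

definition tensor_relations ::
  "('k::field \<Rightarrow> 'a::ab_group_add \<Rightarrow> 'a) \<Rightarrow> ('k \<Rightarrow> 'b::ab_group_add \<Rightarrow> 'b) \<Rightarrow> ('a \<times> 'b \<Rightarrow>\<^sub>0 'k) set"
where
  "tensor_relations sA sB = module.span free_scale
     ({gen (a + a', b) - gen (a, b) - gen (a', b) | a a' b. True}
    \<union> {gen (a, b + b') - gen (a, b) - gen (a, b') | a b b'. True}
    \<union> {gen (sA c a, b) - free_scale c (gen (a, b)) | c a b. True}
    \<union> {gen (a, sB c b) - free_scale c (gen (a, b)) | c a b. True})"

definition tensor3_relations ::
  "('k::field \<Rightarrow> 'a::ab_group_add \<Rightarrow> 'a) \<Rightarrow> ('a \<times> 'a \<times> 'a \<Rightarrow>\<^sub>0 'k) set" where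
  "tensor3_relations s = module.span free_scale
     ({gen (a + a', b, d) - gen (a, b, d) - gen (a', b, d) | a a' b d. True}
    \<union> {gen (a, b + b', d) - gen (a, b, d) - gen (a, b', d) | a b b' d. True}
    \<union> {gen (a, b, d + d') - gen (a, b, d) - gen (a, b, d') | a b d d'. True}
    \<union> {gen (s c a, b, d) - free_scale c (gen (a, b, d)) | c a b d. True}
    \<union> {gen (a, s c b, d) - free_scale c (gen (a, b, d)) | c a b d. True}
    \<union> {gen (a, b, s c d) - free_scale c (gen (a, b, d)) | c a b d. True})"

definition tensor_eq ::
  "('k::field \<Rightarrow> 'a::ab_group_add \<Rightarrow> 'a) \<Rightarrow> ('k \<Rightarrow> 'b::ab_group_add \<Rightarrow> 'b)
    \<Rightarrow> ('a \<times> 'b \<Rightarrow>\<^sub>0 'k) \<Rightarrow> ('a \<times> 'b \<Rightarrow>\<^sub>0 'k) \<Rightarrow> bool" where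
  "tensor_eq sA sB x y \<longleftrightarrow> x - y \<in> tensor_relations sA sB"

definition tensor3_eq ::
  "('k::field \<Rightarrow> 'a::ab_group_add \<Rightarrow> 'a)
    \<Rightarrow> ('a \<times> 'a \<times> 'a \<Rightarrow>\<^sub>0 'k) \<Rightarrow> ('a \<times> 'a \<times> 'a \<Rightarrow>\<^sub>0 'k) \<Rightarrow> bool" where
  "tensor3_eq s x y \<longleftrightarrow> x - y \<in> tensor3_relations s"

definition tensor ::
  "('k::field \<Rightarrow> 'a::ab_group_add \<Rightarrow> 'a) \<Rightarrow> ('k \<Rightarrow> 'b::ab_group_add \<Rightarrow> 'b)
    \<Rightarrow> ('a \<times> 'b \<Rightarrow>\<^sub>0 'k) set set" where
  "tensor sA sB = UNIV // {(x, y). tensor_eq sA sB x y}"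

section \<open>Hopf algebras\<close>

text \<open>The comultiplication, a map from \<open>H\<close> to the tensor square of \<open>H\<close>, is given by choosing for each
  \<open>h\<close> a representative \<open>\<Delta> h\<close> in the free vector space on \<open>H \<times> H\<close>.  Every condition below is invariant
  under changing the representatives, so the choice is immaterial.  For bilinear \<open>f\<close> the
  Sweedler sum of the values \<open>f(h', h'')\<close> is \<open>free_lift s (\<lambda>(h', h''). f h' h'') (\<Delta> h)\<close>.\<close>

locale hopf_algebra = algebra_over sH
  for sH :: "'k::field \<Rightarrow> 'h::ring_1 \<Rightarrow> 'h" +
  fixes \<Delta> :: "'h \<Rightarrow> ('h \<times> 'h \<Rightarrow>\<^sub>0 'k)"
    and \<epsilon> :: "'h \<Rightarrow> 'k"
    and S :: "'h \<Rightarrow> 'h"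
  assumes comult_add: "tensor_eq sH sH (\<Delta> (g + h)) (\<Delta> g + \<Delta> h)"
    and comult_scale: "tensor_eq sH sH (\<Delta> (sH c h)) (free_scale c (\<Delta> h))"
    and comult_one: "tensor_eq sH sH (\<Delta> 1) (gen (1, 1))"
    and comult_mult: "tensor_eq sH sH (\<Delta> (g * h))
          (free_lift free_scale (\<lambda>(g', g''). free_lift free_scale
             (\<lambda>(h', h''). gen (g' * h', g'' * h'')) (\<Delta> h)) (\<Delta> g))"
    and coassoc: "tensor3_eq sH
          (free_lift free_scale (\<lambda>(x, y). free_lift free_scale
             (\<lambda>(x', x''). gen (x', x'', y)) (\<Delta> x)) (\<Delta> h))
          (free_lift free_scale (\<lambda>(x, y). free_lift free_scale
             (\<lambda>(y', y''). gen (x, y', y'')) (\<Delta> y)) (\<Delta> h))"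
    and counit_linear: "Vector_Spaces.linear sH (*) \<epsilon>"
    and counit_one: "\<epsilon> 1 = 1"
    and counit_mult: "\<epsilon> (g * h) = \<epsilon> g * \<epsilon> h"
    and counit_left: "free_lift sH (\<lambda>(h', h''). sH (\<epsilon> h') h'') (\<Delta> h) = h"
    and counit_right: "free_lift sH (\<lambda>(h', h''). sH (\<epsilon> h'') h') (\<Delta> h) = h"
    and antipode_linear: "Vector_Spaces.linear sH sH S"
    and antipode_left: "free_lift sH (\<lambda>(h', h''). S h' * h'') (\<Delta> h) = sH (\<epsilon> h) 1"
    and antipode_right: "free_lift sH (\<lambda>(h', h''). h' * S h'') (\<Delta> h) = sH (\<epsilon> h) 1"

locale fin_dim_hopf_algebra = hopf_algebra +
  assumes finite_dimensional: "fin_dim sH"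

definition adjoint_action ::
  "('k::field \<Rightarrow> 'h::ring_1 \<Rightarrow> 'h) \<Rightarrow> ('h \<Rightarrow> ('h \<times> 'h \<Rightarrow>\<^sub>0 'k)) \<Rightarrow> ('h \<Rightarrow> 'h) \<Rightarrow> 'h \<Rightarrow> 'h \<Rightarrow> 'h"
where
  "adjoint_action sH \<Delta> S h g = free_lift sH (\<lambda>(h', h''). h' * g * S h'') (\<Delta> h)"

section \<open>Module algebras and the Galois condition\<close>

text \<open>Here \<open>act h a\<close> is the action of \<open>h\<close> on \<open>a\<close>.\<close>

locale module_algebra = hopf_algebra sH \<Delta> \<epsilon> S + A: algebra_over sA
  for sH :: "'k::field \<Rightarrow> 'h::ring_1 \<Rightarrow> 'h"
    and \<Delta> :: "'h \<Rightarrow> ('h \<times> 'h \<Rightarrow>\<^sub>0 'k)"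
    and \<epsilon> :: "'h \<Rightarrow> 'k"
    and S :: "'h \<Rightarrow> 'h"
    and sA :: "'k \<Rightarrow> 'a::ring_1 \<Rightarrow> 'a" +
  fixes act :: "'h \<Rightarrow> 'a \<Rightarrow> 'a"
  assumes act_linear_left: "Vector_Spaces.linear sH sA (\<lambda>h. act h a)"
    and act_linear_right: "Vector_Spaces.linear sA sA (act h)"
    and act_one: "act 1 a = a"
    and act_mult: "act (g * h) a = act g (act h a)"
    and act_on_product: "act h (a * b) = free_lift sA (\<lambda>(h', h''). act h' a * act h'' b) (\<Delta> h)"
    and act_on_one: "act h 1 = sA (\<epsilon> h) 1"

text \<open>\<open>galois_map\<close> is the linear map on the free vector space on \<open>A \<times> H\<close> sending \<open>(a, h)\<close> to
  \<open>b \<mapsto> a (h b)\<close>; being constant on the classes in \<open>tensor sA sH\<close>, it induces \<open>\<pi>\<close> there.\<close>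

definition galois_map ::
  "('k::field \<Rightarrow> 'a::ring_1 \<Rightarrow> 'a) \<Rightarrow> ('h \<Rightarrow> 'a \<Rightarrow> 'a) \<Rightarrow> ('a \<times> 'h \<Rightarrow>\<^sub>0 'k) \<Rightarrow> 'a \<Rightarrow> 'a" where
  "galois_map sA act = free_lift (fun_scale sA) (\<lambda>(a, h). \<lambda>b. a * act h b)"

locale galois_module_algebra = module_algebra +
  assumes galois: "bij_betw (\<lambda>X. the_elem (galois_map sA act ` X))
          (tensor sA sH) {f. Vector_Spaces.linear sA sA f}"

section \<open>Homomorphisms of modules and duals\<close>

text \<open>The source is a subspace \<open>W\<close> of its type, and only the values of a homomorphism on \<open>W\<close>
  are constrained.\<close>

definition module_homs ::
  "'w::ab_group_add set \<Rightarrow> ('k::field \<Rightarrow> 'w \<Rightarrow> 'w) \<Rightarrow> ('h \<Rightarrow> 'w \<Rightarrow> 'w)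
    \<Rightarrow> ('k \<Rightarrow> 'a::ab_group_add \<Rightarrow> 'a) \<Rightarrow> ('h \<Rightarrow> 'a \<Rightarrow> 'a) \<Rightarrow> ('w \<Rightarrow> 'a) set" where
  "module_homs W sW actW sA actA =
     {f. (\<forall>x\<in>W. \<forall>y\<in>W. f (x + y) = f x + f y)
       \<and> (\<forall>c. \<forall>x\<in>W. f (sW c x) = sA c (f x))
       \<and> (\<forall>h. \<forall>x\<in>W. f (actW h x) = actA h (f x))}"

definition module_endos ::
  "('k::field \<Rightarrow> 'a::ab_group_add \<Rightarrow> 'a) \<Rightarrow> ('h \<Rightarrow> 'a \<Rightarrow> 'a) \<Rightarrow> ('a \<Rightarrow> 'a) set" where
  "module_endos sA act = module_homs UNIV sA act sA act"

text \<open>A linear form on a subspace \<open>V\<close> is represented by its extension by \<open>0\<close> to the whole type, so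
  that the vector space operations on the dual are the pointwise ones.\<close>

definition dual_space ::
  "('k::field \<Rightarrow> 'v::ab_group_add \<Rightarrow> 'v) \<Rightarrow> 'v set \<Rightarrow> ('v \<Rightarrow> 'k) set" where
  "dual_space s V =
     {\<xi>. (\<forall>x\<in>V. \<forall>y\<in>V. \<xi> (x + y) = \<xi> x + \<xi> y)
       \<and> (\<forall>c. \<forall>x\<in>V. \<xi> (s c x) = c * \<xi> x)
       \<and> (\<forall>x. x \<notin> V \<longrightarrow> \<xi> x = 0)}"

text \<open>The action on the right dual of a module \<open>V\<close> with action \<open>actV\<close>; the antipode \<open>S\<close> of a
  finite dimensional Hopf algebra is bijective.\<close>

definition right_dual_action ::
  "('h \<Rightarrow> 'h) \<Rightarrow> 'v set \<Rightarrow> ('h \<Rightarrow> 'v \<Rightarrow> 'v) \<Rightarrow> 'h \<Rightarrow> ('v \<Rightarrow> 'k::field) \<Rightarrow> ('v \<Rightarrow> 'k)" where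
  "right_dual_action S V actV h \<xi> = (\<lambda>v. if v \<in> V then \<xi> (actV (inv S h) v) else 0)"

definition dual_bases ::
  "('k::field \<Rightarrow> 'v::ab_group_add \<Rightarrow> 'v) \<Rightarrow> 'v set \<Rightarrow> 'i set \<Rightarrow> ('i \<Rightarrow> 'v) \<Rightarrow> ('i \<Rightarrow> 'v \<Rightarrow> 'k) \<Rightarrow> bool"
where
  "dual_bases s V I e e' \<longleftrightarrow> finite I
     \<and> inj_on e I \<and> \<not> module.dependent s (e ` I) \<and> module.span s (e ` I) = V
     \<and> (\<forall>i\<in>I. e' i \<in> dual_space s V)
     \<and> (\<forall>i\<in>I. \<forall>j\<in>I. e' i (e j) = (if i = j then 1 else 0))"

text \<open>\<open>D_right_dual\<close> is \<open>D(\<^sup>*V) = Hom\<^sub>H(\<^sup>*V, A)\<close> for a subspace \<open>V\<close> of \<open>H\<close> with the adjoint action.\<close>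

definition D_right_dual ::
  "('k::field \<Rightarrow> 'h::ring_1 \<Rightarrow> 'h) \<Rightarrow> ('h \<Rightarrow> ('h \<times> 'h \<Rightarrow>\<^sub>0 'k)) \<Rightarrow> ('h \<Rightarrow> 'h)
    \<Rightarrow> ('k \<Rightarrow> 'a::ring_1 \<Rightarrow> 'a) \<Rightarrow> ('h \<Rightarrow> 'a \<Rightarrow> 'a) \<Rightarrow> 'h set \<Rightarrow> (('h \<Rightarrow> 'k) \<Rightarrow> 'a) set" where
  "D_right_dual sH \<Delta> S sA act V =
     module_homs (dual_space sH V) (fun_scale (*))
       (right_dual_action S V (adjoint_action sH \<Delta> S)) sA act"

definition Psi ::
  "('h \<Rightarrow> 'a::ring_1 \<Rightarrow> 'a) \<Rightarrow> 'i set \<Rightarrow> ('i \<Rightarrow> 'h) \<Rightarrow> ('i \<Rightarrow> 'h \<Rightarrow> 'k)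
    \<Rightarrow> (('h \<Rightarrow> 'k) \<Rightarrow> 'a) \<Rightarrow> 'a \<Rightarrow> 'a" where
  "Psi act I e e' \<tau> = (\<lambda>a. \<Sum>i\<in>I. \<tau> (e' i) * act (e i) a)"

end

theory Submission imports Defs begin

text \<open>
  Write \<open>L\<^sub>a\<close> for left multiplication by \<open>a\<close> on \<open>A\<close>.  The Galois condition says that every linear
  operator on \<open>A\<close> is a sum of operators \<open>L\<^sub>a h\<close>, and that such a sum determines the tensor
  \<open>\<Sum> a \<otimes> h\<close> (\<open>galois_surj\<close>, \<open>galois_lift\<close>).  The Hopf algebra acts on operators by conjugation,
  \<open>(h \<cdot> F)(a) = \<Sum> h' F(S(h'') a)\<close>; the invariants are exactly the \<open>H\<close>-linear operators, and under the
  Galois isomorphism the conjugation action becomes the tensor product of the action on \<open>A\<close> and the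
  adjoint action on \<open>H\<close>.  So for a subspace \<open>V\<close> stable under the adjoint action the space \<open>A V\<close>
  spanned by the \<open>L\<^sub>a v\<close> is stable under conjugation, and the operators \<open>\<Psi>\<^sub>\<tau>\<close> turn out to be exactly the
  \<open>H\<close>-linear operators in \<open>A V\<close> (\<open>Psi_endo\<close>, \<open>op_space_endo_is_Psi\<close>).

  The core is that \<open>A V\<close> is spanned by the \<open>L\<^sub>a r\<close> with \<open>r\<close> an \<open>H\<close>-linear operator in \<open>A V\<close>
  (\<open>op_space_eq_span_endos\<close>).  The reason is that operators form a module over the smash product of
  \<open>A\<close> and \<open>H\<close>, which is \<open>End A\<close>: the identity is a sum of rank one operators \<open>L\<^sub>u P\<^sub>u\<close>, where \<open>P\<^sub>u\<close> has
  its image in \<open>k1\<close> and hence maps every operator to an invariant one.  Now let \<open>R\<close> be the algebra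
  generated by the \<open>\<Psi>\<^sub>\<tau>\<close>.  The elements of \<open>H\<close> whose action lies in the span of the \<open>L\<^sub>a r\<close> with
  \<open>r \<in> R\<close> contain \<open>V\<close>, and they form a subalgebra because \<open>R\<close> commutes with \<open>H\<close>.  Hence they
  exhaust \<open>H\<close>, and every linear operator is a sum of operators \<open>L\<^sub>a r\<close>.  Applying to such an
  expression of an \<open>H\<close>-linear operator one more rank one operator \<open>P = \<lambda>(-)1\<close> with \<open>\<lambda>(1) = 1\<close>
  replaces each \<open>a\<close> by the scalar \<open>\<lambda>(a)\<close> and fixes the operator, so it lies in \<open>R\<close>
  (\<open>endos_generated_by_op_space\<close>).

  Two facts from the theory of Hopf-Galois extensions are needed on the way.  The algebra \<open>A\<close> is
  finite dimensional, because otherwise its linear functionals would not fit into the span of the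
  operators \<open>L\<^sub>b h\<close> with \<open>b\<close>, \<open>h\<close> from bases of \<open>A\<close> and \<open>H\<close> (\<open>functional_not_in_small_span\<close>,
  \<open>finite_dim_A\<close>).  The antipode is bijective: the identity \<open>\<Sum> S(g')((g''a)b) = a (S(g)b)\<close> shows
  that \<open>S(g) = 0\<close> forces \<open>\<Sum> S(g')\<phi>(g'') = 0\<close> for every map \<open>\<phi>(h) = \<Sum> (ha)b\<close>, and by the Galois
  condition these maps include \<open>h \<mapsto> \<xi>(h)1\<close> for every functional \<open>\<xi>\<close> on \<open>H\<close> (\<open>inj_antipode\<close>).
\<close>

section \<open>Linear maps and spans\<close>

text \<open>The rules in \<open>linear_intros\<close> follow the syntax of an expression, so that linearity and bilinearity
  of composite expressions can be shown by repeated introduction.\<close>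

named_theorems linear_intros

lemma linear_add: "Vector_Spaces.linear s t f \<Longrightarrow> f (x + y) = f x + f y"
  by (simp add: Vector_Spaces.linear_iff)

lemma linear_scale: "Vector_Spaces.linear s t f \<Longrightarrow> f (s c x) = t c (f x)"
  by (simp add: Vector_Spaces.linear_iff)

lemma linear_zero: "Vector_Spaces.linear s t f \<Longrightarrow> f 0 = 0"
  using linear_add[of s t f 0 0] by simp

lemma linear_diff: "Vector_Spaces.linear s t f \<Longrightarrow> f (x - y) = f x - f y"
  using linear_add[of s t f "x - y" y] by (simp add: algebra_simps)

lemma linear_sum: "Vector_Spaces.linear s t f \<Longrightarrow> f (sum g B) = (\<Sum>i\<in>B. f (g i))"
  by (induction B rule: infinite_finite_induct) (simp_all add: linear_zero linear_add)

lemma linear_source: "Vector_Spaces.linear s t f \<Longrightarrow> vector_space s"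
  and linear_target: "Vector_Spaces.linear s t f \<Longrightarrow> vector_space t"
  by (simp_all add: Vector_Spaces.linear_iff)

lemma vector_space_zero_scale: "vector_space s \<Longrightarrow> s c 0 = 0"
  by (metis vector_space.vector_space_assms(1) add_cancel_right_right)

lemma vector_space_sum_scale: "vector_space s \<Longrightarrow> s c (sum g B) = (\<Sum>i\<in>B. s c (g i))"
  by (induction B rule: infinite_finite_induct)
    (simp_all add: vector_space_zero_scale vector_space.vector_space_assms(1))

lemma vector_space_fun_scale: "vector_space s \<Longrightarrow> vector_space (fun_scale s)"
  by unfold_locales
    (auto simp: fun_scale_def fun_eq_iff vector_space.vector_space_assms)

lemma vector_space_mult: "vector_space ((*) :: 'k::field \<Rightarrow> 'k \<Rightarrow> 'k)"
  by unfold_locales (simp_all add: algebra_simps)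

lemma linear_identity [linear_intros]: "vector_space s \<Longrightarrow> Vector_Spaces.linear s s (\<lambda>x. x)"
  by (simp add: Vector_Spaces.linear_iff)

lemma linear_comp: "Vector_Spaces.linear t u g \<Longrightarrow> Vector_Spaces.linear s t f
    \<Longrightarrow> Vector_Spaces.linear s u (\<lambda>x. g (f x))"
  by (simp add: Vector_Spaces.linear_iff)

lemma linear_scaling_left [linear_intros]: "vector_space t \<Longrightarrow> Vector_Spaces.linear s (*) f
    \<Longrightarrow> Vector_Spaces.linear s t (\<lambda>x. t (f x) y)"
  by (simp add: Vector_Spaces.linear_iff vector_space.vector_space_assms)

lemma linear_scaling_right [linear_intros]: "Vector_Spaces.linear s t f
    \<Longrightarrow> Vector_Spaces.linear s t (\<lambda>x. t c (f x))"
  by (simp add: Vector_Spaces.linear_iff vector_space.vector_space_assms mult.commute)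

lemma linear_sum_fun [linear_intros]: "vector_space s \<Longrightarrow> vector_space t
    \<Longrightarrow> (\<And>i. i \<in> B \<Longrightarrow> Vector_Spaces.linear s t (\<lambda>x. f x i))
    \<Longrightarrow> Vector_Spaces.linear s t (\<lambda>x. \<Sum>i\<in>B. f x i)"
  by (simp add: Vector_Spaces.linear_iff sum.distrib vector_space_sum_scale)

definition bilinear_map ::
  "('k::field \<Rightarrow> 'a::ab_group_add \<Rightarrow> 'a) \<Rightarrow> ('k \<Rightarrow> 'b::ab_group_add \<Rightarrow> 'b)
    \<Rightarrow> ('k \<Rightarrow> 'c::ab_group_add \<Rightarrow> 'c) \<Rightarrow> ('a \<Rightarrow> 'b \<Rightarrow> 'c) \<Rightarrow> bool" where
  "bilinear_map s t u f \<longleftrightarrow>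
     (\<forall>y. Vector_Spaces.linear s u (\<lambda>x. f x y)) \<and> (\<forall>x. Vector_Spaces.linear t u (f x))"

lemma bilinear_mapI [linear_intros]:
  assumes "\<And>y. Vector_Spaces.linear s u (\<lambda>x. f x y)" "\<And>x. Vector_Spaces.linear t u (\<lambda>y. f x y)"
  shows "bilinear_map s t u f"
  using assms by (simp add: bilinear_map_def)

lemma bilinear_target: "bilinear_map s t u f \<Longrightarrow> vector_space u"
  by (auto simp: bilinear_map_def Vector_Spaces.linear_iff)

lemma subspace_linear_zeros:
  assumes "Vector_Spaces.linear s t f" shows "module.subspace s {x. f x = 0}"
proof -
  interpret s: vector_space s by (rule linear_source[OF assms])
  interpret t: vector_space t by (rule linear_target[OF assms])
  show ?thesis
    by (auto simp: s.subspace_def linear_zero[OF assms] linear_add[OF assms] linear_scale[OF assms])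
qed

lemma linear_zero_on_span:
  assumes "Vector_Spaces.linear s t f" "\<And>x. x \<in> B \<Longrightarrow> f x = 0" "x \<in> module.span s B"
  shows "f x = 0"
proof -
  interpret s: vector_space s by (rule linear_source[OF assms(1)])
  show ?thesis using s.span_minimal[OF _ subspace_linear_zeros[OF assms(1)], of B] assms by auto
qed

lemma linear_image_span:
  assumes "Vector_Spaces.linear s t f" "x \<in> module.span s B"
  shows "f x \<in> module.span t (f ` B)"
proof -
  interpret module_hom s t f using assms(1) by (simp add: linear_iff_module_hom)
  show ?thesis using assms(2) span_image by blast
qed

lemma linear_span_into:
  assumes "Vector_Spaces.linear s t f" "x \<in> module.span s B" "module.subspace t T"
    and "\<And>b. b \<in> B \<Longrightarrow> f b \<in> T"
  shows "f x \<in> T"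
proof -
  interpret t: vector_space t by (rule linear_target[OF assms(1)])
  show ?thesis
    using linear_image_span[OF assms(1,2)] t.span_minimal[OF _ assms(3), of "f ` B"] assms(4) by blast
qed

lemma linear_functional_extend:
  assumes "vector_space s" "\<not> module.dependent s B"
  obtains l where "Vector_Spaces.linear s ((*) :: 'k::field \<Rightarrow> 'k \<Rightarrow> 'k) l" "\<And>b. b \<in> B \<Longrightarrow> l b = f b"
proof -
  interpret vector_space_pair s "(*) :: 'k \<Rightarrow> 'k \<Rightarrow> 'k"
    by (rule vector_space_pair.intro[OF assms(1) vector_space_mult])
  show thesis using linear_independent_extend[OF assms(2), of f] that by blast
qed

lemma finite_dual_basis:
  assumes "vector_space s" "finite B" "\<not> module.dependent s B" "module.span s B = UNIV"
  obtains l where "\<And>b. Vector_Spaces.linear s (*) (l b)" "\<And>x. (\<Sum>b\<in>B. s (l b x) b) = x"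
proof -
  interpret vector_space s by fact
  show thesis
  proof
    show "Vector_Spaces.linear s (*) (\<lambda>x. representation B x b)" for b
      using assms(3,4)
      by (simp add: Vector_Spaces.linear_iff assms(1) vector_space_mult representation_add
          representation_scale)
    show "(\<Sum>b\<in>B. s (representation B x b) b) = x" for x
      using sum_representation_eq[OF assms(3) _ assms(2), of x] assms(4) by simp
  qed
qed

lemma linear_eval: "vector_space s \<Longrightarrow> Vector_Spaces.linear (fun_scale s) s (\<lambda>F. F x)"
  by (simp add: Vector_Spaces.linear_iff vector_space_fun_scale) (simp add: fun_scale_def)

lemma linear_into_funI:
  assumes "vector_space s" "vector_space t" "\<And>x. Vector_Spaces.linear s t (\<lambda>z. f z x)"
  shows "Vector_Spaces.linear s (fun_scale t) f"
  using linear_add[OF assms(3)] linear_scale[OF assms(3)]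
  by (auto simp: Vector_Spaces.linear_iff assms vector_space_fun_scale fun_eq_iff fun_scale_def)

lemma sum_fun_apply: "(\<Sum>i\<in>B. f i) x = (\<Sum>i\<in>B. f i x)" for f :: "'i \<Rightarrow> 'a \<Rightarrow> 'b::ab_group_add"
  by (induction B rule: infinite_finite_induct) simp_all

lemma subalgebra_hull:
  assumes "vector_space s" shows "subalgebra s m u (subalgebra s m u hull X)"
proof (rule hull_in)
  interpret vector_space s by fact
  show "subalgebra s m u (\<Inter>T)" if "Ball T (subalgebra s m u)" for T
    using that subspace_Inter[of T] by (auto simp: subalgebra_def)
qed

section \<open>Free vector spaces and tensor products\<close>

lemma lookup_free_scale [simp]:
  "Poly_Mapping.lookup (free_scale c x) p = c * Poly_Mapping.lookup x p"
  by (simp add: free_scale_def Poly_Mapping.map.rep_eq when_def)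

lemma vector_space_free_scale: "vector_space free_scale"
  by unfold_locales (auto intro!: poly_mapping_eqI simp: lookup_add algebra_simps)

lemma free_lift_superset:
  assumes "vector_space s" "finite K" "Poly_Mapping.keys x \<subseteq> K"
  shows "free_lift s f x = (\<Sum>p\<in>K. s (Poly_Mapping.lookup x p) (f p))"
proof -
  interpret vector_space s by fact
  show ?thesis unfolding free_lift_def
    by (rule sum.mono_neutral_left) (use assms in \<open>auto simp: in_keys_iff\<close>)
qed

lemma linear_free_lift:
  assumes "vector_space s"
  shows "Vector_Spaces.linear free_scale s (free_lift s f)"
proof -
  interpret vector_space s by fact
  have "free_lift s f (x + y) = free_lift s f x + free_lift s f y" for x y
  proof -
    let ?K = "Poly_Mapping.keys x \<union> Poly_Mapping.keys y"
    have "Poly_Mapping.keys (x + y) \<subseteq> ?K" by (rule Poly_Mapping.keys_add)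
    then show ?thesis
      by (simp add: free_lift_superset[OF assms, of ?K] lookup_add scale_left_distrib sum.distrib)
  qed
  moreover have "free_lift s f (free_scale c x) = s c (free_lift s f x)" for c x
    by (subst (1 2) free_lift_superset[OF assms, of "Poly_Mapping.keys x"])
      (auto simp: in_keys_iff scale_sum_right)
  ultimately show ?thesis
    by (simp add: Vector_Spaces.linear_iff vector_space_free_scale assms)
qed

lemma free_lift_gen [simp]: "vector_space s \<Longrightarrow> free_lift s f (gen p) = f p"
  by (simp add: free_lift_def vector_space.vector_space_assms)

lemma linear_free_lift_apply:
  assumes "Vector_Spaces.linear s t g"
  shows "g (free_lift s f x) = free_lift t (\<lambda>p. g (f p)) x"
  by (simp add: free_lift_def linear_sum[OF assms] linear_scale[OF assms])

text \<open>Iterated linear extensions collapse; this turns a comultiplication inside a sum into a nested sum.\<close>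

lemma free_lift_free_lift:
  "vector_space s \<Longrightarrow>
    free_lift s f (free_lift free_scale g x) = free_lift s (\<lambda>p. free_lift s f (g p)) x"
  by (rule linear_free_lift_apply[OF linear_free_lift])

lemma linear_free_lift_fun [linear_intros]:
  assumes "vector_space s" "vector_space t" "\<And>p. Vector_Spaces.linear s t (\<lambda>z. f z p)"
  shows "Vector_Spaces.linear s t (\<lambda>z. free_lift t (f z) x)"
  unfolding free_lift_def by (intro linear_sum_fun linear_scaling_right assms)

lemma linear_free_lift_pair_fun [linear_intros]:
  assumes "vector_space s" "vector_space t" "\<And>x y. Vector_Spaces.linear s t (\<lambda>z. f z x y)"
  shows "Vector_Spaces.linear s t (\<lambda>z. free_lift t (\<lambda>(x, y). f z x y) X)"
proof -
  have "Vector_Spaces.linear s t (\<lambda>z. case p of (x, y) \<Rightarrow> f z x y)" for p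
    by (cases p) (simp add: assms(3))
  then show ?thesis by (intro linear_free_lift_fun assms)
qed

text \<open>Bilinear maps respect the defining relations, so they are well defined on the tensor product.\<close>

lemma free_lift_tensor_relations:
  assumes "bilinear_map sA sB s f" "x \<in> tensor_relations sA sB"
  shows "free_lift s (\<lambda>(a, b). f a b) x = 0"
proof -
  have l: "Vector_Spaces.linear sA s (\<lambda>x. f x y)" and r: "Vector_Spaces.linear sB s (f y')" for y y'
    using assms(1) by (auto simp: bilinear_map_def)
  note s = linear_target[OF l] and lin = linear_free_lift[OF linear_target[OF l]]
  show ?thesis
    using assms(2) unfolding tensor_relations_def
    by (rule linear_zero_on_span[OF lin, rotated])
      (auto simp: s linear_diff[OF lin] linear_scale[OF lin] linear_add[OF l] linear_add[OF r]
        linear_scale[OF l] linear_scale[OF r])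
qed

lemma free_lift_tensor_eq:
  assumes "tensor_eq sA sB x y" "bilinear_map sA sB s f"
  shows "free_lift s (\<lambda>(a, b). f a b) x = free_lift s (\<lambda>(a, b). f a b) y"
proof -
  note lin = linear_free_lift[OF bilinear_target[OF assms(2)]]
  show ?thesis using free_lift_tensor_relations[OF assms(2), of "x - y"] assms(1)
    by (simp add: tensor_eq_def linear_diff[OF lin])
qed

lemma free_lift_tensor3_eq:
  assumes "tensor3_eq sA x y"
    and l: "\<And>b c. Vector_Spaces.linear sA s (\<lambda>a. f a b c)"
    and m: "\<And>a c. Vector_Spaces.linear sA s (\<lambda>b. f a b c)"
    and r: "\<And>a b. Vector_Spaces.linear sA s (\<lambda>c. f a b c)"
  shows "free_lift s (\<lambda>(a, b, c). f a b c) x = free_lift s (\<lambda>(a, b, c). f a b c) y"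
proof -
  note s = linear_target[OF l] and lin = linear_free_lift[OF linear_target[OF l]]
  have "free_lift s (\<lambda>(a, b, c). f a b c) (x - y) = 0"
    using assms(1) unfolding tensor3_eq_def tensor3_relations_def
    by (rule linear_zero_on_span[OF lin, rotated])
      (auto simp: s linear_diff[OF lin] linear_scale[OF lin] linear_add[OF l] linear_add[OF r]
        linear_scale[OF l] linear_scale[OF r] linear_add[OF m] linear_scale[OF m])
  then show ?thesis by (simp add: linear_diff[OF lin])
qed

lemma free_lift_swap:
  assumes "vector_space s"
  shows "free_lift s (\<lambda>p. free_lift s (\<lambda>q. f p q) y) x = free_lift s (\<lambda>q. free_lift s (\<lambda>p. f p q) x) y"
proof -
  interpret vector_space s by fact
  show ?thesis unfolding free_lift_def scale_sum_right
    by (subst sum.swap) (simp add: mult.commute)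
qed

lemma subspace_free_lift:
  assumes "vector_space s" "module.subspace s T" "\<And>p. f p \<in> T"
  shows "free_lift s f X \<in> T"
proof -
  interpret vector_space s by fact
  show ?thesis unfolding free_lift_def by (intro subspace_sum subspace_scale assms)
qed

lemma free_lift_fun_scale:
  "vector_space s \<Longrightarrow> free_lift (fun_scale s) f X = (\<lambda>x. free_lift s (\<lambda>p. f p x) X)"
  by (rule ext) (simp add: linear_free_lift_apply[OF linear_eval])

section \<open>Hopf algebras in Sweedler notation\<close>

context hopf_algebra
begin

text \<open>For bilinear \<open>f\<close> this is independent of the representative \<open>\<Delta> h\<close>.  The scalar multiplication of the
  target space is an argument because sums in \<open>k\<close>, \<open>H\<close> and \<open>A\<close> occur.\<close>

definition sweedler ::
  "('k \<Rightarrow> 'b::ab_group_add \<Rightarrow> 'b) \<Rightarrow> 'h \<Rightarrow> ('h \<Rightarrow> 'h \<Rightarrow> 'b) \<Rightarrow> 'b" where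
  "sweedler s h f = free_lift s (\<lambda>(x, y). f x y) (\<Delta> h)"

lemma vector_space_sH: "vector_space sH" ..

lemma linear_mult_left [linear_intros]:
  "Vector_Spaces.linear s sH f \<Longrightarrow> Vector_Spaces.linear s sH (\<lambda>x. f x * c)"
  by (simp add: Vector_Spaces.linear_iff distrib_right scale_mult_left)

lemma linear_mult_right [linear_intros]:
  "Vector_Spaces.linear s sH f \<Longrightarrow> Vector_Spaces.linear s sH (\<lambda>x. c * f x)"
  by (simp add: Vector_Spaces.linear_iff distrib_left scale_mult_right)

lemma linear_antipode [linear_intros]:
  "Vector_Spaces.linear s sH f \<Longrightarrow> Vector_Spaces.linear s sH (\<lambda>x. S (f x))"
  by (rule linear_comp[OF antipode_linear])

lemma linear_counit [linear_intros]:
  "Vector_Spaces.linear s sH f \<Longrightarrow> Vector_Spaces.linear s (*) (\<lambda>x. \<epsilon> (f x))"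
  by (rule linear_comp[OF counit_linear])

lemma linear_sweedler_fun [linear_intros]:
  assumes "vector_space s" "vector_space t" "\<And>x y. Vector_Spaces.linear s t (\<lambda>z. f z x y)"
  shows "Vector_Spaces.linear s t (\<lambda>z. sweedler t h (f z))"
  unfolding sweedler_def by (intro linear_free_lift_pair_fun assms)

lemma linear_sweedler:
  assumes "bilinear_map sH sH s f"
  shows "Vector_Spaces.linear sH s (\<lambda>h. sweedler s h f)"
proof -
  note s = bilinear_target[OF assms] and lin = linear_free_lift[OF bilinear_target[OF assms]]
  show ?thesis
    using free_lift_tensor_eq[OF comult_add assms] free_lift_tensor_eq[OF comult_scale assms]
    by (simp add: Vector_Spaces.linear_iff vector_space_sH s sweedler_def
        linear_add[OF lin] linear_scale[OF lin])
qed

lemma linear_sweedler_arg [linear_intros]: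
  assumes "Vector_Spaces.linear t sH g" "bilinear_map sH sH s f"
  shows "Vector_Spaces.linear t s (\<lambda>z. sweedler s (g z) f)"
  using linear_comp[OF linear_sweedler[OF assms(2)] assms(1)] .

lemma linear_sweedler_apply:
  "Vector_Spaces.linear s t g \<Longrightarrow> g (sweedler s h f) = sweedler t h (\<lambda>x y. g (f x y))"
  by (simp add: sweedler_def linear_free_lift_apply case_prod_unfold)

lemma sweedler_swap:
  "vector_space s \<Longrightarrow> sweedler s g (\<lambda>x y. sweedler s h (\<lambda>u v. f x y u v))
     = sweedler s h (\<lambda>u v. sweedler s g (\<lambda>x y. f x y u v))"
  using free_lift_swap[of s "\<lambda>p q. f (fst p) (snd p) (fst q) (snd q)"]
  by (simp add: sweedler_def case_prod_unfold)

lemma sweedler_sum: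
  assumes "vector_space s"
  shows "sweedler s h (\<lambda>x y. \<Sum>i\<in>B. f i x y) = (\<Sum>i\<in>B. sweedler s h (f i))"
  unfolding sweedler_def free_lift_def case_prod_unfold vector_space_sum_scale[OF assms]
  by (rule sum.swap)

lemma sweedler_one:
  assumes "bilinear_map sH sH s f" shows "sweedler s 1 f = f 1 1"
proof -
  note s = bilinear_target[OF assms]
  show ?thesis using free_lift_tensor_eq[OF comult_one assms] by (simp add: sweedler_def s)
qed

lemma sweedler_mult:
  assumes "bilinear_map sH sH s f"
  shows "sweedler s (g * h) f
    = sweedler s g (\<lambda>g' g''. sweedler s h (\<lambda>h' h''. f (g' * h') (g'' * h'')))"
proof -
  note s = bilinear_target[OF assms]
  show ?thesis using free_lift_tensor_eq[OF comult_mult assms]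
    by (simp add: sweedler_def s free_lift_free_lift case_prod_unfold)
qed

lemma sweedler_coassoc:
  assumes "\<And>b c. Vector_Spaces.linear sH s (\<lambda>a. f a b c)"
    and "\<And>a c. Vector_Spaces.linear sH s (\<lambda>b. f a b c)"
    and "\<And>a b. Vector_Spaces.linear sH s (\<lambda>c. f a b c)"
  shows "sweedler s h (\<lambda>x y. sweedler s x (\<lambda>x' x''. f x' x'' y))
    = sweedler s h (\<lambda>x y. sweedler s y (\<lambda>y' y''. f x y' y''))"
  using free_lift_tensor3_eq[OF coassoc assms] linear_target[OF assms(1)]
  by (simp add: sweedler_def free_lift_free_lift case_prod_unfold)

lemma sweedler_counit_left:
  assumes "Vector_Spaces.linear sH s f"
  shows "sweedler s h (\<lambda>x y. s (\<epsilon> x) (f y)) = f h"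
  using linear_free_lift_apply[OF assms, of "\<lambda>(x, y). sH (\<epsilon> x) y" "\<Delta> h"]
  by (simp add: sweedler_def case_prod_unfold linear_scale[OF assms]
      counit_left[unfolded case_prod_unfold])

lemma sweedler_counit_right:
  assumes "Vector_Spaces.linear sH s f"
  shows "sweedler s h (\<lambda>x y. s (\<epsilon> y) (f x)) = f h"
  using linear_free_lift_apply[OF assms, of "\<lambda>(x, y). sH (\<epsilon> y) x" "\<Delta> h"]
  by (simp add: sweedler_def case_prod_unfold linear_scale[OF assms]
      counit_right[unfolded case_prod_unfold])

lemma sweedler_antipode_left:
  assumes "Vector_Spaces.linear sH s f"
  shows "sweedler s h (\<lambda>x y. f (S x * y)) = s (\<epsilon> h) (f 1)"
  using linear_free_lift_apply[OF assms, of "\<lambda>(x, y). S x * y" "\<Delta> h"]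
  by (simp add: sweedler_def case_prod_unfold linear_scale[OF assms]
      antipode_left[unfolded case_prod_unfold])

lemma sweedler_antipode_right:
  assumes "Vector_Spaces.linear sH s f"
  shows "sweedler s h (\<lambda>x y. f (x * S y)) = s (\<epsilon> h) (f 1)"
  using linear_free_lift_apply[OF assms, of "\<lambda>(x, y). x * S y" "\<Delta> h"]
  by (simp add: sweedler_def case_prod_unfold linear_scale[OF assms]
      antipode_right[unfolded case_prod_unfold])

text \<open>Coassociativity applied to two elements at once, interleaved in the way in which a bilinear map on
  \<open>H \<otimes> H\<close> sees the coalgebra structure of \<open>H \<otimes> H\<close>.\<close>

lemma sweedler_coassoc_pair:
  assumes "\<And>b c x y z. Vector_Spaces.linear sH s (\<lambda>a. f a b c x y z)"
    and "\<And>a c x y z. Vector_Spaces.linear sH s (\<lambda>b. f a b c x y z)"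
    and "\<And>a b x y z. Vector_Spaces.linear sH s (\<lambda>c. f a b c x y z)"
    and "\<And>a b c y z. Vector_Spaces.linear sH s (\<lambda>x. f a b c x y z)"
    and "\<And>a b c x z. Vector_Spaces.linear sH s (\<lambda>y. f a b c x y z)"
    and "\<And>a b c x y. Vector_Spaces.linear sH s (\<lambda>z. f a b c x y z)"
  shows "sweedler s g (\<lambda>g1 g'. sweedler s h (\<lambda>h1 h'. sweedler s g' (\<lambda>g2 g3.
           sweedler s h' (\<lambda>h2 h3. f g1 g2 g3 h1 h2 h3))))
       = sweedler s g (\<lambda>g' g3. sweedler s h (\<lambda>h' h3. sweedler s g' (\<lambda>g1 g2.
           sweedler s h' (\<lambda>h1 h2. f g1 g2 g3 h1 h2 h3))))"
proof -
  note s = linear_target[OF assms(1)]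
  note lin = linear_sweedler_fun[OF vector_space_sH s]
  have "sweedler s g (\<lambda>g1 g'. sweedler s h (\<lambda>h1 h'. sweedler s g' (\<lambda>g2 g3.
           sweedler s h' (\<lambda>h2 h3. f g1 g2 g3 h1 h2 h3))))
       = sweedler s g (\<lambda>g1 g'. sweedler s g' (\<lambda>g2 g3. sweedler s h (\<lambda>h1 h'.
           sweedler s h' (\<lambda>h2 h3. f g1 g2 g3 h1 h2 h3))))"
    by (subst (2) sweedler_swap[OF s]) (rule refl)
  also have "\<dots> = sweedler s g (\<lambda>g' g3. sweedler s g' (\<lambda>g1 g2. sweedler s h (\<lambda>h1 h'.
           sweedler s h' (\<lambda>h2 h3. f g1 g2 g3 h1 h2 h3))))"
    by (rule sweedler_coassoc[symmetric]) (rule lin, rule lin, rule assms)+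
  also have "\<dots> = sweedler s g (\<lambda>g' g3. sweedler s g' (\<lambda>g1 g2. sweedler s h (\<lambda>h' h3.
           sweedler s h' (\<lambda>h1 h2. f g1 g2 g3 h1 h2 h3))))"
    by (simp only: sweedler_coassoc[OF assms(4-6)])
  also have "\<dots> = sweedler s g (\<lambda>g' g3. sweedler s h (\<lambda>h' h3. sweedler s g' (\<lambda>g1 g2.
           sweedler s h' (\<lambda>h1 h2. f g1 g2 g3 h1 h2 h3))))"
    by (subst (2) sweedler_swap[OF s]) (rule refl)
  finally show ?thesis .
qed

lemma antipode_one: "S 1 = 1"
proof -
  have "sweedler sH 1 (\<lambda>x y. S x * y) = S 1 * 1"
    by (rule sweedler_one) (intro linear_intros vector_space_sH)
  moreover have "sweedler sH 1 (\<lambda>x y. S x * y) = sH (\<epsilon> 1) 1"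
    by (rule sweedler_antipode_left) (intro linear_intros vector_space_sH)
  ultimately show ?thesis by (simp add: counit_one)
qed

lemma counit_antipode: "\<epsilon> (S h) = \<epsilon> h"
proof -
  have "\<epsilon> (S h) = sweedler (*) h (\<lambda>x y. \<epsilon> y * \<epsilon> (S x))"
    by (rule sweedler_counit_right[symmetric]) (intro linear_intros vector_space_sH)
  also have "\<dots> = sweedler (*) h (\<lambda>x y. \<epsilon> (S x * y))"
    by (simp add: counit_mult mult.commute)
  also have "\<dots> = \<epsilon> h"
    by (subst sweedler_antipode_left) (simp_all add: counit_linear counit_one)
  finally show ?thesis .
qed

text \<open>Both \<open>g \<otimes> h \<mapsto> S(gh)\<close> and \<open>g \<otimes> h \<mapsto> S(h)S(g)\<close> are convolution inverses of the multiplication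
  \<open>H \<otimes> H \<rightarrow> H\<close>, the first one on the left and the second one on the right.  The sum \<open>?T\<close> below is the
  triple convolution product, evaluated in both ways.\<close>

lemma antipode_mult: "S (g * h) = S h * S g"
proof -
  let ?T = "sweedler sH g (\<lambda>g1 g'. sweedler sH h (\<lambda>h1 h'. sweedler sH g' (\<lambda>g2 g3.
           sweedler sH h' (\<lambda>h2 h3. S (g1 * h1) * (g2 * (h2 * S h3) * S g3)))))"
  have r: "sweedler sH g' (\<lambda>g2 g3. sweedler sH h' (\<lambda>h2 h3. x * (g2 * (h2 * S h3) * S g3)))
      = sH (\<epsilon> h') (sH (\<epsilon> g') x)" for g' h' x
  proof -
    have "sweedler sH h' (\<lambda>h2 h3. x * (g2 * (h2 * S h3) * S g3))
        = sH (\<epsilon> h') (x * (g2 * 1 * S g3))" for g2 g3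
      by (rule sweedler_antipode_right) (intro linear_intros vector_space_sH)
    moreover have "sweedler sH g' (\<lambda>g2 g3. sH (\<epsilon> h') (x * (g2 * S g3)))
        = sH (\<epsilon> g') (sH (\<epsilon> h') (x * 1))"
      by (rule sweedler_antipode_right) (intro linear_intros vector_space_sH)
    ultimately show ?thesis by (simp add: mult.commute)
  qed
  have l: "sweedler sH g' (\<lambda>g1 g2. sweedler sH h' (\<lambda>h1 h2. S (g1 * h1) * (g2 * (h2 * y) * z)))
      = sH (\<epsilon> g') (sH (\<epsilon> h') (y * z))" for g' h' y z
  proof -
    have "sweedler sH g' (\<lambda>g1 g2. sweedler sH h' (\<lambda>h1 h2. S (g1 * h1) * (g2 * h2) * (y * z)))
        = sweedler sH (g' * h') (\<lambda>u v. S u * v * (y * z))"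
      by (rule sweedler_mult[symmetric]) (intro linear_intros vector_space_sH)
    also have "\<dots> = sH (\<epsilon> (g' * h')) (1 * (y * z))"
      by (rule sweedler_antipode_left) (intro linear_intros vector_space_sH)
    finally show ?thesis by (simp add: mult.assoc counit_mult)
  qed
  have "?T = sweedler sH g (\<lambda>g1 g'. sweedler sH h (\<lambda>h1 h'. sH (\<epsilon> h') (sH (\<epsilon> g') (S (g1 * h1)))))"
    by (simp only: r)
  also have "\<dots> = sweedler sH g (\<lambda>g1 g'. sH (\<epsilon> g') (S (g1 * h)))"
    by (subst sweedler_counit_right) (intro linear_intros vector_space_sH refl)+
  also have "\<dots> = S (g * h)"
    by (subst sweedler_counit_right) (intro linear_intros vector_space_sH refl)+
  finally have 1: "?T = S (g * h)" .
  have "?T = sweedler sH g (\<lambda>g' g3. sweedler sH h (\<lambda>h' h3. sweedler sH g' (\<lambda>g1 g2.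
           sweedler sH h' (\<lambda>h1 h2. S (g1 * h1) * (g2 * (h2 * S h3) * S g3)))))"
    by (rule sweedler_coassoc_pair) (intro linear_intros vector_space_sH)+
  also have "\<dots> = sweedler sH g (\<lambda>g' g3. sweedler sH h (\<lambda>h' h3.
      sH (\<epsilon> g') (sH (\<epsilon> h') (S h3 * S g3))))"
    by (simp only: l)
  also have "\<dots> = sweedler sH g (\<lambda>g' g3. sH (\<epsilon> g') (S h * S g3))"
  proof -
    have "sweedler sH h (\<lambda>h' h3. sH (\<epsilon> h') (sH (\<epsilon> g') (S h3 * S g3))) = sH (\<epsilon> g') (S h * S g3)"
      for g' g3 by (rule sweedler_counit_left) (intro linear_intros vector_space_sH)
    then show ?thesis by (simp add: mult.commute)
  qed
  also have "\<dots> = S h * S g"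
    by (subst sweedler_counit_left) (intro linear_intros vector_space_sH refl)+
  finally show ?thesis using 1 by simp
qed

abbreviation ad :: "'h \<Rightarrow> 'h \<Rightarrow> 'h" where "ad \<equiv> adjoint_action sH \<Delta> S"

lemma ad_eq_sweedler: "ad h g = sweedler sH h (\<lambda>x y. x * g * S y)"
  by (simp add: adjoint_action_def sweedler_def)

lemma linear_ad_left [linear_intros]:
  "Vector_Spaces.linear s sH f \<Longrightarrow> Vector_Spaces.linear s sH (\<lambda>x. ad (f x) g)"
  unfolding ad_eq_sweedler by (intro linear_intros vector_space_sH)

lemma linear_ad_right [linear_intros]:
  "Vector_Spaces.linear s sH f \<Longrightarrow> Vector_Spaces.linear s sH (\<lambda>x. ad h (f x))"
  unfolding ad_eq_sweedler by (intro linear_intros vector_space_sH) (rule linear_source)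

lemma ad_one: "ad 1 v = v"
  unfolding ad_eq_sweedler
  by (subst sweedler_one) (auto intro!: linear_intros vector_space_sH simp: antipode_one)

lemma ad_mult: "ad (g * h) v = ad g (ad h v)"
proof -
  have "ad (g * h) v = sweedler sH g (\<lambda>g' g''. sweedler sH h (\<lambda>h' h''. g' * h' * v * S (g'' * h'')))"
    unfolding ad_eq_sweedler by (rule sweedler_mult) (intro linear_intros vector_space_sH)
  also have "\<dots> = sweedler sH g (\<lambda>g' g''. g' * ad h v * S g'')"
  proof -
    have "g' * sweedler sH h (\<lambda>x y. x * v * S y) * S g''
      = sweedler sH h (\<lambda>x y. g' * (x * v * S y) * S g'')" for g' g''
      by (rule linear_sweedler_apply[where g = "\<lambda>x. g' * x * S g''"])
        (intro linear_intros vector_space_sH)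
    then show ?thesis by (simp add: ad_eq_sweedler antipode_mult mult.assoc)
  qed
  finally show ?thesis by (simp add: ad_eq_sweedler)
qed

end

section \<open>The conjugation action on operators\<close>

context module_algebra
begin

lemma vector_space_sA: "vector_space sA" ..

lemma linear_mult_left_A [linear_intros]:
  "Vector_Spaces.linear s sA f \<Longrightarrow> Vector_Spaces.linear s sA (\<lambda>x. f x * c)"
  by (simp add: Vector_Spaces.linear_iff distrib_right A.scale_mult_left)

lemma linear_mult_right_A [linear_intros]:
  "Vector_Spaces.linear s sA f \<Longrightarrow> Vector_Spaces.linear s sA (\<lambda>x. c * f x)"
  by (simp add: Vector_Spaces.linear_iff distrib_left A.scale_mult_right)

lemma linear_act_left [linear_intros]:
  "Vector_Spaces.linear s sH f \<Longrightarrow> Vector_Spaces.linear s sA (\<lambda>x. act (f x) a)"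
  by (rule linear_comp[OF act_linear_left])

lemma linear_act_right [linear_intros]:
  "Vector_Spaces.linear s sA f \<Longrightarrow> Vector_Spaces.linear s sA (\<lambda>x. act h (f x))"
  by (rule linear_comp[OF act_linear_right])

lemma act_product: "act h (a * b) = sweedler sA h (\<lambda>x y. act x a * act y b)"
  by (simp add: act_on_product sweedler_def)

text \<open>The invariant linear operators of this action are the \<open>H\<close>-linear ones; the two directions are
  \<open>conj_act_endo\<close> and \<open>endo_if_conj_act_trivial\<close>.\<close>

definition conj_act :: "'h \<Rightarrow> ('a \<Rightarrow> 'a) \<Rightarrow> 'a \<Rightarrow> 'a" where
  "conj_act h F = (\<lambda>a. sweedler sA h (\<lambda>x y. act x (F (act (S y) a))))"

lemma linear_conj_act: "Vector_Spaces.linear (fun_scale sA) (fun_scale sA) (conj_act h)"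
proof -
  have *: "Vector_Spaces.linear (fun_scale sA) sA (\<lambda>F. conj_act h F a)" for a
    unfolding conj_act_def
    by (intro linear_intros vector_space_fun_scale vector_space_sA linear_eval)
  show ?thesis
    using linear_add[OF *] linear_scale[OF *]
    by (auto simp: Vector_Spaces.linear_iff vector_space_fun_scale[OF vector_space_sA]
        fun_scale_def fun_eq_iff)
qed

lemma linear_conj_act_left [linear_intros]:
  assumes "Vector_Spaces.linear sA sA F" "Vector_Spaces.linear s sH f"
  shows "Vector_Spaces.linear s sA (\<lambda>z. conj_act (f z) F a)"
  unfolding conj_act_def
  by (intro linear_intros vector_space_sA vector_space_sH linear_comp[OF assms(1)] assms(2))

lemma linear_conj_act_arg [linear_intros]:
  assumes "Vector_Spaces.linear sA sA F"
  shows "Vector_Spaces.linear sA sA (conj_act h F)"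
  unfolding conj_act_def
  by (intro linear_intros vector_space_sA linear_comp[OF assms(1)])

lemma conj_act_one:
  assumes "Vector_Spaces.linear sA sA F" shows "conj_act 1 F = F"
proof
  fix a
  have "conj_act 1 F a = act 1 (F (act (S 1) a))" unfolding conj_act_def
    by (rule sweedler_one) (intro linear_intros vector_space_sH linear_comp[OF assms])
  then show "conj_act 1 F a = F a" by (simp add: antipode_one act_one)
qed

lemma conj_act_mult:
  assumes "Vector_Spaces.linear sA sA F"
  shows "conj_act (g * h) F = conj_act g (conj_act h F)"
proof
  fix a
  have "conj_act (g * h) F a = sweedler sA g (\<lambda>g' g''. sweedler sA h (\<lambda>h' h''.
      act (g' * h') (F (act (S (g'' * h'')) a))))"
    unfolding conj_act_def
    by (rule sweedler_mult) (intro linear_intros vector_space_sH linear_comp[OF assms])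
  also have "\<dots> = conj_act g (conj_act h F) a"
  proof -
    have "act g' (sweedler sA h (\<lambda>x y. act x (F (act (S y) b))))
      = sweedler sA h (\<lambda>x y. act g' (act x (F (act (S y) b))))" for g' b
      by (rule linear_sweedler_apply[OF act_linear_right])
    then show ?thesis by (simp add: conj_act_def act_mult antipode_mult)
  qed
  finally show "conj_act (g * h) F a = conj_act g (conj_act h F) a" .
qed

lemma conj_act_act: "conj_act h (act g) a = act (ad h g) a"
  unfolding conj_act_def ad_eq_sweedler
  by (subst linear_sweedler_apply[OF act_linear_left]) (simp add: act_mult)

text \<open>The operators on \<open>A\<close> with left multiplication and conjugation form a module over the smash product:
  \<open>h \<cdot> (aF) = \<Sum> (h'a)(h'' \<cdot> F)\<close>.  Together with \<open>conj_act_act\<close> this identifies conjugation on the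
  operators \<open>a h\<close> with the diagonal action on \<open>A \<otimes> H\<close>.\<close>

lemma conj_act_mult_op:
  assumes "Vector_Spaces.linear sA sA F"
  shows "conj_act h (\<lambda>b. a * F b) b = sweedler sA h (\<lambda>x y. act x a * conj_act y F b)"
proof -
  have "conj_act h (\<lambda>b. a * F b) b
    = sweedler sA h (\<lambda>x y. sweedler sA x (\<lambda>x' x''. act x' a * act x'' (F (act (S y) b))))"
    by (simp add: conj_act_def act_product)
  also have "\<dots> = sweedler sA h (\<lambda>x y. sweedler sA y (\<lambda>y' y''. act x a * act y' (F (act (S y'') b))))"
    by (rule sweedler_coassoc) (intro linear_intros vector_space_sH linear_comp[OF assms])+
  also have "\<dots> = sweedler sA h (\<lambda>x y. act x a * conj_act y F b)"
  proof -
    have "act x a * sweedler sA y (\<lambda>y' y''. act y' (F (act (S y'') b)))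
      = sweedler sA y (\<lambda>y' y''. act x a * act y' (F (act (S y'') b)))" for x y
      by (rule linear_sweedler_apply) (intro linear_intros vector_space_sA)
    then show ?thesis by (simp add: conj_act_def)
  qed
  finally show ?thesis .
qed

lemma module_endos_iff:
  "F \<in> module_endos sA act \<longleftrightarrow> Vector_Spaces.linear sA sA F \<and> (\<forall>h a. F (act h a) = act h (F a))"
  by (auto simp: module_endos_def module_homs_def Vector_Spaces.linear_iff vector_space_sA)

lemma conj_act_endo:
  assumes "F \<in> module_endos sA act" shows "conj_act h F a = sA (\<epsilon> h) (F a)"
proof -
  have F: "Vector_Spaces.linear sA sA F" "\<And>h a. F (act h a) = act h (F a)"
    using assms by (auto simp: module_endos_iff)
  have "conj_act h F a = sweedler sA h (\<lambda>x y. act (x * S y) (F a))"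
    by (simp add: conj_act_def F(2) act_mult)
  also have "\<dots> = sA (\<epsilon> h) (act 1 (F a))" by (rule sweedler_antipode_right[OF act_linear_left])
  finally show ?thesis by (simp add: act_one)
qed

lemma conj_act_mult_endo:
  assumes "F \<in> module_endos sA act" shows "conj_act h (\<lambda>b. a * F b) = (\<lambda>b. act h a * F b)"
proof
  fix b
  have "conj_act h (\<lambda>b. a * F b) b = sweedler sA h (\<lambda>x y. sA (\<epsilon> y) (act x a * F b))"
    using assms by (subst conj_act_mult_op) (simp_all add: conj_act_endo A.scale_mult_right module_endos_iff)
  also have "\<dots> = act h a * F b"
    by (rule sweedler_counit_right) (intro linear_intros vector_space_sH)
  finally show "conj_act h (\<lambda>b. a * F b) b = act h a * F b" .
qed

text \<open>Insert \<open>\<epsilon>(h'') = \<Sum> S(h'')h'''\<close> into the argument: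
  \<open>h F(a) = \<Sum> h' F(S(h'') h''' a) = \<Sum> (h' \<cdot> F)(h'' a) = F(h a)\<close>.\<close>

lemma endo_if_conj_act_trivial:
  assumes F: "Vector_Spaces.linear sA sA F" and inv: "\<And>h a. conj_act h F a = sA (\<epsilon> h) (F a)"
  shows "F \<in> module_endos sA act"
proof -
  have "act h (F a) = F (act h a)" for h a
  proof -
    have "act h (F a) = sweedler sA h (\<lambda>x y. sA (\<epsilon> y) (act x (F a)))"
      by (rule sweedler_counit_right[symmetric]) (intro linear_intros vector_space_sH)
    also have "\<dots> = sweedler sA h (\<lambda>x y. sweedler sA y (\<lambda>y' y''. act x (F (act (S y' * y'') a))))"
    proof -
      have "sweedler sA y (\<lambda>y' y''. act x (F (act (S y' * y'') a))) = sA (\<epsilon> y) (act x (F (act 1 a)))"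
        for x y
        by (rule sweedler_antipode_left) (intro linear_intros vector_space_sH linear_comp[OF F])
      then show ?thesis by (simp add: act_one)
    qed
    also have "\<dots> = sweedler sA h (\<lambda>x y. sweedler sA x (\<lambda>x' x''. act x' (F (act (S x'' * y) a))))"
      by (rule sweedler_coassoc[symmetric]) (intro linear_intros vector_space_sH linear_comp[OF F])+
    also have "\<dots> = sweedler sA h (\<lambda>x y. sA (\<epsilon> x) (F (act y a)))"
      using inv by (simp add: conj_act_def act_mult)
    also have "\<dots> = F (act h a)"
      by (rule sweedler_counit_left) (intro linear_intros vector_space_sH linear_comp[OF F])
    finally show ?thesis .
  qed
  with F show ?thesis by (simp add: module_endos_iff)
qed

lemma galois_map_apply:
  "galois_map sA act X b = free_lift sA (\<lambda>(a, h). a * act h b) X"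
  unfolding galois_map_def free_lift_fun_scale[OF vector_space_sA] by (simp add: case_prod_unfold)

end

section \<open>Spaces of functionals are too large for few generators\<close>

text \<open>An infinite set \<open>B\<close> injects its square, so finite lists over \<open>B\<close> together with a number can be
  encoded in \<open>B\<close>: fold the list with a pairing and record its length, which makes the code
  unambiguous.\<close>

lemma lists_times_nat_inject:
  assumes "infinite B" "inj_on h D" "h ` D \<subseteq> B"
  obtains g :: "'d list \<times> nat \<Rightarrow> 'b" where "inj_on g (lists D \<times> UNIV)" "g ` (lists D \<times> UNIV) \<subseteq> B"
proof -
  have "ordLeq3 (card_of (B \<times> B)) (card_of B)"
    using card_of_Times_same_infinite[OF assms(1)] ordIso_iff_ordLeq by blast
  then obtain p where p: "inj_on p (B \<times> B)" "p ` (B \<times> B) \<subseteq> B"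
    using card_of_ordLeq[of "B \<times> B" B] by metis
  obtain \<nu> :: "nat \<Rightarrow> 'b" where \<nu>: "inj \<nu>" "range \<nu> \<subseteq> B"
    using infinite_countable_subset[OF assms(1)] by blast
  define code where "code = rec_list (\<nu> 0) (\<lambda>x _ r. p (h x, r))"
  have code: "code [] = \<nu> 0" "code (x # xs) = p (h x, code xs)" for x xs
    by (simp_all add: code_def)
  have pB: "p (x, y) \<in> B" if "x \<in> B" "y \<in> B" for x y using p(2) that by blast
  have pD: "x = x' \<and> y = y'" if "p (x, y) = p (x', y')" "x \<in> B" "y \<in> B" "x' \<in> B" "y' \<in> B"
    for x y x' y' using inj_onD[OF p(1) that(1)] that by auto
  have hB: "h x \<in> B" if "x \<in> D" for x using assms(3) that by blast
  have \<nu>B: "\<nu> i \<in> B" for i using \<nu>(2) by blast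
  have codeB: "code xs \<in> B" if "xs \<in> lists D" for xs
    using that by (induction xs) (auto simp: code pB hB \<nu>B)
  have code_inj: "xs = ys" if "xs \<in> lists D" "ys \<in> lists D" "length xs = length ys" "code xs = code ys"
    for xs ys
    using that(3,1,2,4)
  proof (induction xs ys rule: list_induct2)
    case (Cons x xs y ys)
    then show ?case
      using pD[of "h x" "code xs" "h y" "code ys"] inj_onD[OF assms(2), of x y]
      by (auto simp: code hB codeB)
  qed simp
  define g where "g = (\<lambda>(xs, i). p (\<nu> i, p (\<nu> (length xs), code xs)))"
  have "inj_on g (lists D \<times> UNIV)"
  proof (rule inj_onI)
    fix a b assume "a \<in> lists D \<times> UNIV" "b \<in> lists D \<times> UNIV" "g a = g b"
    then obtain xs i ys j where a: "a = (xs, i)" "b = (ys, j)"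
      and xs: "xs \<in> lists D" and ys: "ys \<in> lists D"
      and eq: "p (\<nu> i, p (\<nu> (length xs), code xs)) = p (\<nu> j, p (\<nu> (length ys), code ys))"
      by (auto simp: g_def simp del: in_lists_conv_set)
    from pD[OF eq \<nu>B pB[OF \<nu>B codeB[OF xs]] \<nu>B pB[OF \<nu>B codeB[OF ys]]]
    have 1: "\<nu> i = \<nu> j" and 2: "p (\<nu> (length xs), code xs) = p (\<nu> (length ys), code ys)" by auto
    from pD[OF 2 \<nu>B codeB[OF xs] \<nu>B codeB[OF ys]] 1
    show "a = b" using \<nu>(1) code_inj xs ys a by (auto dest: injD)
  qed
  moreover have "g ` (lists D \<times> UNIV) \<subseteq> B"
    by (auto simp: g_def simp del: in_lists_conv_set intro!: pB \<nu>B codeB)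
  ultimately show thesis by (rule that)
qed

text \<open>The \<open>n + 1\<close> delta functions are independent and cannot all lie in the span of \<open>n\<close> functions.\<close>

lemma delta_not_in_span:
  assumes s: "vector_space s" and "u \<noteq> 0" "finite T" "card T \<le> n"
  shows "\<exists>i\<le>n. (\<lambda>j. if j = i then u else 0) \<notin> module.span (fun_scale s) T"
proof (rule ccontr)
  interpret s: vector_space s by (rule s)
  interpret f: vector_space "fun_scale s :: _ \<Rightarrow> (nat \<Rightarrow> _) \<Rightarrow> _" by (rule vector_space_fun_scale[OF s])
  let ?\<delta> = "\<lambda>i j :: nat. if j = i then u else 0"
  assume "\<not> ?thesis"
  then have sp: "?\<delta> ` {..n} \<subseteq> f.span T" by auto
  have "?\<delta> i \<noteq> ?\<delta> j" if "i \<noteq> j" for i j using that assms(2) by (auto dest: fun_cong[of _ _ i])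
  then have inj: "inj_on ?\<delta> {..n}" by (meson inj_onI)
  have "f.independent (?\<delta> ` {..n})"
  proof (rule f.independent_if_scalars_zero)
    fix c x assume sum: "(\<Sum>x\<in>?\<delta> ` {..n}. fun_scale s (c x) x) = 0" and "x \<in> ?\<delta> ` {..n}"
    then obtain i where i: "i \<le> n" "x = ?\<delta> i" by auto
    have "0 = (\<Sum>j\<le>n. fun_scale s (c (?\<delta> j)) (?\<delta> j)) i"
      using sum by (simp add: sum.reindex[OF inj])
    also have "\<dots> = (\<Sum>j\<le>n. fun_scale s (c (?\<delta> j)) (?\<delta> j) i)"
      by (induction n) (simp_all add: plus_fun_def)
    also have "\<dots> = (\<Sum>j\<le>n. if j = i then s (c (?\<delta> i)) u else 0)"
      by (rule sum.cong) (auto simp: fun_scale_def)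
    finally show "c x = 0" using i assms(2) by simp
  qed simp
  from f.independent_span_bound[OF assms(3) this sp] show False
    using card_image[OF inj] assms(4) by simp
qed

text \<open>This is the diagonal argument behind \<open>dim V\<^sup>* > dim V\<close> for infinite dimensional \<open>V\<close>.  It reserves for
  every finite list \<open>xs\<close> over \<open>D\<close> a block of \<open>length xs + 1\<close> basis vectors, the blocks being disjoint.
  By counting dimensions, on that block some delta function avoids the span of the \<open>G d\<close> with \<open>d\<close> in
  \<open>xs\<close>.  The functional that agrees with the chosen delta function on each block avoids the span of
  all \<open>G d\<close>.\<close>

lemma functional_not_in_small_span:
  fixes s :: "'k::field \<Rightarrow> 'a::ab_group_add \<Rightarrow> 'a" and t :: "'k \<Rightarrow> 'b::ab_group_add \<Rightarrow> 'b"
    and G :: "'c \<Rightarrow> 'a \<Rightarrow> 'b" and h :: "'c \<Rightarrow> 'a"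
  assumes s: "vector_space s" and ind: "\<not> module.dependent s B" and "infinite B"
    and h: "inj_on h D" "h ` D \<subseteq> B" and t: "vector_space t" and "u \<noteq> 0"
  shows "\<exists>l. Vector_Spaces.linear s (*) l \<and> (\<lambda>x. t (l x) u) \<notin> module.span (fun_scale t) (G ` D)"
proof -
  interpret t: vector_space t by (rule t)
  interpret f: vector_space "fun_scale t :: _ \<Rightarrow> ('a \<Rightarrow> _) \<Rightarrow> _" by (rule vector_space_fun_scale[OF t])
  obtain g :: "'c list \<times> nat \<Rightarrow> 'a" where g: "inj_on g (lists D \<times> UNIV)" "g ` (lists D \<times> UNIV) \<subseteq> B"
    using lists_times_nat_inject[OF \<open>infinite B\<close> h] .
  \<comment> \<open>Restriction to the block of \<open>xs\<close>, whose members are enumerated by \<open>j \<le> length xs\<close>.\<close>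
  define cut where "cut = (\<lambda>xs (F :: 'a \<Rightarrow> 'b) j. if j \<le> length xs then F (g (xs, j)) else 0)"
  have "\<exists>i\<le>length xs. (\<lambda>j. if j = i then u else 0) \<notin> module.span (fun_scale t) (cut xs ` G ` set xs)"
    for xs
    by (rule delta_not_in_span[OF t \<open>u \<noteq> 0\<close>])
      (auto intro: order_trans[OF card_image_le] card_length)
  then obtain d where d: "d xs \<le> length xs"
      "(\<lambda>j. if j = d xs then u else 0) \<notin> module.span (fun_scale t) (cut xs ` G ` set xs)" for xs
    by metis
  obtain l where l: "Vector_Spaces.linear s (*) l"
      "\<And>b. b \<in> B \<Longrightarrow> l b = (if \<exists>xs\<in>lists D. b = g (xs, d xs) then 1 else 0)"
    using linear_functional_extend[OF s ind, of "\<lambda>b. if \<exists>xs\<in>lists D. b = g (xs, d xs) then 1 else 0"]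
    by metis
  have "(\<lambda>x. t (l x) u) \<notin> f.span (G ` D)"
  proof
    assume "(\<lambda>x. t (l x) u) \<in> f.span (G ` D)"
    then obtain T r where T: "finite T" "T \<subseteq> G ` D" "(\<lambda>x. t (l x) u) = (\<Sum>a\<in>T. fun_scale t (r a) a)"
      unfolding f.span_explicit by blast
    then obtain Q where Q: "finite Q" "Q \<subseteq> D" "T = G ` Q" by (meson finite_subset_image)
    then obtain xs where xs: "set xs = Q" using finite_list by blast
    then have mem: "(\<lambda>x. t (l x) u) \<in> f.span (G ` set xs)"
      unfolding T(3) using Q(3) by (auto intro!: f.span_sum f.span_scale intro: f.span_base)
    have lin: "Vector_Spaces.linear (fun_scale t) (fun_scale t) (cut xs)"
      by (auto simp: Vector_Spaces.linear_iff vector_space_fun_scale[OF t] cut_def fun_eq_iff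
          fun_scale_def vector_space_zero_scale[OF t])
    have xsD: "xs \<in> lists D" using xs Q by auto
    have "cut xs (\<lambda>x. t (l x) u) = (\<lambda>j. if j = d xs then u else 0)"
    proof
      fix j
      have "g (xs, j) \<in> B" using g(2) xsD by blast
      moreover have "(\<exists>ys\<in>lists D. g (xs, j) = g (ys, d ys)) \<longleftrightarrow> j = d xs"
        using inj_onD[OF g(1)] xsD by blast
      ultimately show "cut xs (\<lambda>x. t (l x) u) j = (if j = d xs then u else 0)"
        using d(1)[of xs] by (auto simp: cut_def l(2))
    qed
    with linear_image_span[OF lin mem] d(2)[of xs] show False by simp
  qed
  with l(1) show ?thesis by blast
qed

text \<open>For infinite \<open>B\<close> and finite \<open>C\<close> the index set \<open>B \<times> C\<close> injects into \<open>B\<close>, so that the diagonal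
  argument excludes an infinite basis.\<close>

lemma finite_dim_if_functionals_in_small_span:
  fixes s :: "'k::field \<Rightarrow> 'a::ab_group_add \<Rightarrow> 'a" and G :: "'a \<Rightarrow> 'c \<Rightarrow> 'a \<Rightarrow> 'b::ab_group_add"
  assumes s: "vector_space s" and t: "vector_space t" and "u \<noteq> 0" and C: "finite C"
    and sp: "\<And>l B. Vector_Spaces.linear s (*) l \<Longrightarrow> module.span s B = UNIV \<Longrightarrow>
       (\<lambda>x. t (l x) u) \<in> module.span (fun_scale t) {G b c |b c. b \<in> B \<and> c \<in> C}"
  shows "\<exists>B. finite B \<and> \<not> module.dependent s B \<and> module.span s B = UNIV"
proof -
  interpret s: vector_space s by (rule s)
  obtain B where B: "s.independent B" "UNIV \<subseteq> s.span B"
    using s.maximal_independent_subset[of UNIV] by blast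
  have "finite B"
  proof (rule ccontr)
    assume inf: "infinite B"
    have "ordLeq3 (card_of (B \<times> C)) (card_of B)"
    proof (cases "C = {}")
      case True then show ?thesis by (simp add: card_of_empty)
    next
      case False
      have "ordLeq3 (card_of C) (card_of B)"
        using inf C card_of_ordLeq_finite ordLeq_total card_of_Well_order by metis
      with card_of_Times_infinite[OF inf False] show ?thesis using ordIso_iff_ordLeq by blast
    qed
    then obtain h where "inj_on h (B \<times> C)" "h ` (B \<times> C) \<subseteq> B"
      using card_of_ordLeq[of "B \<times> C" B] by metis
    from functional_not_in_small_span[OF s B(1) inf this t \<open>u \<noteq> 0\<close>, of "\<lambda>(b, c). G b c"]
    obtain l where "Vector_Spaces.linear s (*) l"
      "(\<lambda>x. t (l x) u) \<notin> module.span (fun_scale t) ((\<lambda>(b, c). G b c) ` (B \<times> C))" by blast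
    moreover have "(\<lambda>(b, c). G b c) ` (B \<times> C) = {G b c |b c. b \<in> B \<and> c \<in> C}" by auto
    ultimately show False using sp[of l B] B(2) by auto
  qed
  with B show ?thesis by blast
qed

section \<open>Consequences of the Galois condition\<close>

locale fin_dim_galois_module_algebra = galois_module_algebra sH \<Delta> \<epsilon> S sA act
  for sH :: "'k::field \<Rightarrow> 'h::ring_1 \<Rightarrow> 'h"
    and \<Delta> :: "'h \<Rightarrow> ('h \<times> 'h \<Rightarrow>\<^sub>0 'k)"
    and \<epsilon> :: "'h \<Rightarrow> 'k"
    and S :: "'h \<Rightarrow> 'h"
    and sA :: "'k \<Rightarrow> 'a::ring_1 \<Rightarrow> 'a"
    and act :: "'h \<Rightarrow> 'a \<Rightarrow> 'a" +
  assumes fin_dim_H: "fin_dim sH"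
begin

lemma galois_map_tensor_eq:
  assumes "tensor_eq sA sH X Y" shows "galois_map sA act X = galois_map sA act Y"
  unfolding fun_eq_iff galois_map_apply
  by (intro allI free_lift_tensor_eq[OF assms] linear_intros vector_space_sA vector_space_sH)

lemma tensor_eq_refl: "tensor_eq sA sH X X"
  by (simp add: tensor_eq_def tensor_relations_def
      module.span_zero[OF vector_space_free_scale[folded module_iff_vector_space]])

lemma galois_map_class:
  "the_elem (galois_map sA act ` {Y. tensor_eq sA sH X Y}) = galois_map sA act X"
proof -
  have "galois_map sA act ` {Y. tensor_eq sA sH X Y} = {galois_map sA act X}"
  proof (rule equalityI; rule subsetI)
    fix F assume "F \<in> galois_map sA act ` {Y. tensor_eq sA sH X Y}"
    then show "F \<in> {galois_map sA act X}" by (metis (no_types, lifting) galois_map_tensor_eq imageE mem_Collect_eq singletonI)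
  next
    fix F assume "F \<in> {galois_map sA act X}"
    then show "F \<in> galois_map sA act ` {Y. tensor_eq sA sH X Y}" using tensor_eq_refl[of X] by auto
  qed
  then show ?thesis by simp
qed

lemma galois_surj:
  assumes "Vector_Spaces.linear sA sA T" obtains X where "galois_map sA act X = T"
proof -
  have "T \<in> (\<lambda>X. the_elem (galois_map sA act ` X)) ` tensor sA sH"
    using galois assms by (simp add: bij_betw_def)
  then obtain X where X: "T = the_elem (galois_map sA act ` {Y. tensor_eq sA sH X Y})"
    by (auto simp: tensor_def quotient_def Image_def)
  then show thesis using that by (simp add: galois_map_class)
qed

text \<open>Injectivity of the Galois map in the form in which it is used: an operator \<open>\<Sum> a h\<close> determines the
  tensor \<open>\<Sum> a \<otimes> h\<close>, hence the value \<open>\<Sum> f(a, h)\<close> of every bilinear map.\<close>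

lemma galois_lift:
  assumes "galois_map sA act X = galois_map sA act Y" "bilinear_map sA sH s f"
  shows "free_lift s (\<lambda>(a, h). f a h) X = free_lift s (\<lambda>(a, h). f a h) Y"
proof -
  let ?c = "\<lambda>X. {Y. tensor_eq sA sH X Y}"
  have cl: "?c X \<in> tensor sA sH" for X
    by (auto simp: tensor_def quotient_def Image_def)
  have "?c X = ?c Y"
    by (rule inj_onD[OF bij_betw_imp_inj_on[OF galois] _ cl cl]) (simp only: galois_map_class assms(1))
  then have "tensor_eq sA sH X Y" using tensor_eq_refl[of Y] by auto
  then show ?thesis by (rule free_lift_tensor_eq[OF _ assms(2)])
qed

text \<open>The image of \<open>A \<otimes> V\<close> under the Galois map.\<close>

definition op_space :: "'h set \<Rightarrow> ('a \<Rightarrow> 'a) set" where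
  "op_space V = module.span (fun_scale sA) {(\<lambda>b. a * act v b) | a v. v \<in> V}"

interpretation Op: vector_space "fun_scale sA :: 'k \<Rightarrow> ('a \<Rightarrow> 'a) \<Rightarrow> _"
  by (rule vector_space_fun_scale[OF vector_space_sA])

lemma subspace_linear_ops: "Op.subspace {F. Vector_Spaces.linear sA sA F}"
  by (auto simp: Op.subspace_def Vector_Spaces.linear_iff vector_space_sA fun_scale_def
      algebra_simps A.scale_right_distrib mult.commute)

lemma op_space_base: "v \<in> V \<Longrightarrow> (\<lambda>b. a * act v b) \<in> op_space V"
  unfolding op_space_def by (rule Op.span_base) blast

lemma subspace_op_space: "Op.subspace (op_space V)"
  unfolding op_space_def by simp

lemma op_space_linear:
  assumes "F \<in> op_space V" shows "Vector_Spaces.linear sA sA F"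
proof -
  have "{(\<lambda>b. a * act v b) | a v. v \<in> V} \<subseteq> {F. Vector_Spaces.linear sA sA F}"
    by (auto intro!: linear_mult_right_A act_linear_right)
  from Op.span_minimal[OF this subspace_linear_ops] show ?thesis
    using assms by (auto simp: op_space_def)
qed

lemma linear_mult_op: "Vector_Spaces.linear (fun_scale sA) (fun_scale sA) (\<lambda>F b. a * F b)"
  by (intro linear_into_funI vector_space_fun_scale vector_space_sA linear_mult_right_A linear_eval)

lemma op_space_mult:
  assumes "F \<in> op_space V" shows "(\<lambda>b. a * F b) \<in> op_space V"
proof (rule linear_span_into[OF linear_mult_op assms[unfolded op_space_def] subspace_op_space])
  fix F assume "F \<in> {(\<lambda>b. a * act v b) | a v. v \<in> V}"
  then obtain a' v where "F = (\<lambda>b. a' * act v b)" "v \<in> V" by auto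
  then show "(\<lambda>b. a * F b) \<in> op_space V"
    using op_space_base[of v V "a * a'"] by (simp add: mult.assoc)
qed

lemma op_space_conj_act:
  assumes "\<And>h v. v \<in> V \<Longrightarrow> ad h v \<in> V" "F \<in> op_space V"
  shows "conj_act h F \<in> op_space V"
  using assms(2) unfolding op_space_def[of V]
proof (rule linear_span_into[OF linear_conj_act])
  show "Op.subspace (Op.span {(\<lambda>b. a * act v b) | a v. v \<in> V})" by simp
  fix F assume "F \<in> {(\<lambda>b. a * act v b) | a v. v \<in> V}"
  then obtain a v where F: "F = (\<lambda>b. a * act v b)" "v \<in> V" by auto
  have "conj_act h F = (\<lambda>b. sweedler sA h (\<lambda>x y. act x a * act (ad y v) b))"
    unfolding F by (rule ext, subst conj_act_mult_op) (simp_all add: act_linear_right conj_act_act)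
  also have "\<dots> = free_lift (fun_scale sA) (\<lambda>(x, y) b. act x a * act (ad y v) b) (\<Delta> h)"
    by (simp add: free_lift_fun_scale[OF vector_space_sA] sweedler_def case_prod_unfold)
  also have "\<dots> \<in> op_space V"
    by (rule subspace_free_lift[OF Op.vector_space_axioms subspace_op_space])
      (auto intro!: op_space_base assms(1) F(2))
  finally show "conj_act h F \<in> Op.span {(\<lambda>b. a * act v b) | a v. v \<in> V}"
    by (simp add: op_space_def)
qed

lemma galois_map_in_span:
  assumes "A.span B = UNIV" "span C = UNIV"
  shows "galois_map sA act X \<in> Op.span {(\<lambda>x. b * act c x) | b c. b \<in> B \<and> c \<in> C}" (is "_ \<in> Op.span ?G")
proof -
  have 1: "(\<lambda>x. b * act h x) \<in> Op.span ?G" if "b \<in> B" for b h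
  proof (rule linear_span_into[where f = "\<lambda>h x. b * act h x"])
    show "Vector_Spaces.linear sH (fun_scale sA) (\<lambda>h x. b * act h x)"
      by (intro linear_into_funI vector_space_sH vector_space_sA linear_intros)
    show "h \<in> span C" using assms(2) by simp
  qed (use that in \<open>auto intro!: Op.span_base\<close>)
  have "(\<lambda>x. a * act h x) \<in> Op.span ?G" for a h
  proof (rule linear_span_into[where f = "\<lambda>a x. a * act h x"])
    show "Vector_Spaces.linear sA (fun_scale sA) (\<lambda>a x. a * act h x)"
      by (intro linear_into_funI vector_space_sA linear_intros)
    show "a \<in> A.span B" using assms(1) by simp
  qed (use 1 in auto)
  then show ?thesis unfolding galois_map_def
    by (intro subspace_free_lift[OF Op.vector_space_axioms]) auto
qed

text \<open>Every functional \<open>l\<close> on \<open>A\<close> gives the operator \<open>l(-)1\<close>, which lies in the span of the operators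
  \<open>b c\<close> with \<open>b\<close> from a basis of \<open>A\<close> and \<open>c\<close> from a finite spanning set of \<open>H\<close>.\<close>

lemma finite_dim_A: "\<exists>B. finite B \<and> \<not> A.dependent B \<and> A.span B = UNIV"
proof -
  obtain C where C: "finite C" "span C = UNIV" using fin_dim_H by (auto simp: fin_dim_def)
  show ?thesis
  proof (rule finite_dim_if_functionals_in_small_span[OF vector_space_sA vector_space_sA one_neq_zero C(1),
        where G = "\<lambda>b h x. b * act h x"])
    fix l B assume l: "Vector_Spaces.linear sA (*) l" and B: "A.span B = UNIV"
    have "Vector_Spaces.linear sA sA (\<lambda>x. sA (l x) 1)" by (intro linear_intros vector_space_sA l)
    then obtain X where "galois_map sA act X = (\<lambda>x. sA (l x) 1)" by (rule galois_surj)
    then show "(\<lambda>x. sA (l x) 1) \<in> Op.span {(\<lambda>x. b * act c x) | b c. b \<in> B \<and> c \<in> C}"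
      using galois_map_in_span[OF B C(2), of X] by simp
  qed
qed

text \<open>With a basis \<open>B\<close> of \<open>A\<close> and its coordinate functionals \<open>l\<close>, the identity of \<open>A\<close> is the sum of the
  rank one operators \<open>L\<^sub>u P\<^sub>u\<close> with \<open>P\<^sub>u = l\<^sub>u(-)1\<close>; the element \<open>X u\<close> represents \<open>P\<^sub>u\<close> in \<open>A \<otimes> H\<close>.\<close>

lemma galois_partition_of_unity:
  obtains B :: "'a set" and l X where "finite B"
    "\<And>x. (\<Sum>u\<in>B. sA (l u x) u) = x" "\<And>u. galois_map sA act (X u) = (\<lambda>x. sA (l u x) 1)"
proof -
  obtain B where B: "finite B" "\<not> A.dependent B" "A.span B = UNIV" using finite_dim_A by blast
  obtain l where l: "\<And>b. Vector_Spaces.linear sA (*) (l b)" "\<And>x. (\<Sum>b\<in>B. sA (l b x) b) = x"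
    using finite_dual_basis[OF vector_space_sA B] by blast
  have "\<exists>X. galois_map sA act X = (\<lambda>x. sA (l u x) 1)" for u
  proof -
    have "Vector_Spaces.linear sA sA (\<lambda>x. sA (l u x) 1)" by (intro linear_intros vector_space_sA l)
    then show ?thesis using galois_surj by blast
  qed
  then obtain X where "\<And>u. galois_map sA act (X u) = (\<lambda>x. sA (l u x) 1)" by metis
  with B(1) l(2) show thesis by (rule that)
qed

text \<open>The identity \<open>h = \<Sum> (hu) P\<^sub>u\<close> of operators on \<open>A\<close>, transported to \<open>A \<otimes> H\<close>.\<close>

lemma free_lift_partition_of_unity:
  assumes l: "\<And>x. (\<Sum>u\<in>B. sA (l u x) u) = x"
    and X: "\<And>u. galois_map sA act (X u) = (\<lambda>x. sA (l u x) 1)"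
    and f: "bilinear_map sA sH s f"
  shows "(\<Sum>u\<in>B. free_lift s (\<lambda>(c, g). f (act h u * c) g) (X u)) = f 1 h"
proof -
  note s = bilinear_target[OF f]
  define Y where "Y = (\<Sum>u\<in>B. free_lift free_scale (\<lambda>(c, g). gen (act h u * c, g)) (X u))"
  have lift_Y: "free_lift t k Y = (\<Sum>u\<in>B. free_lift t (\<lambda>(c, g). k (act h u * c, g)) (X u))"
    if t: "vector_space t" for t :: "'k \<Rightarrow> 'z::ab_group_add \<Rightarrow> 'z" and k
    unfolding Y_def by (subst linear_sum[OF linear_free_lift[OF t]])
      (simp add: free_lift_free_lift t case_prod_unfold)
  have "galois_map sA act Y x = act h x" for x
  proof -
    have "galois_map sA act Y x = (\<Sum>u\<in>B. act h u * galois_map sA act (X u) x)"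
      unfolding galois_map_apply lift_Y[OF vector_space_sA]
      by (subst linear_free_lift_apply[of sA sA "\<lambda>z. _ * z"])
        (auto intro!: linear_intros vector_space_sA sum.cong simp: case_prod_unfold mult.assoc)
    also have "\<dots> = act h (\<Sum>u\<in>B. sA (l u x) u)"
      by (simp add: X linear_sum[OF act_linear_right] linear_scale[OF act_linear_right]
          A.scale_mult_right)
    finally show ?thesis by (simp add: l)
  qed
  then have "galois_map sA act Y = galois_map sA act (gen (1, h))"
    by (intro ext) (simp add: galois_map_apply vector_space_sA)
  from galois_lift[OF this f] show ?thesis by (simp add: lift_Y s)
qed

text \<open>The operator \<open>P = l(-)1\<close> has its image in \<open>k1\<close>, where \<open>H\<close> acts through the counit; hence
  \<open>h P = \<epsilon>(h) P\<close>, which is transported to \<open>A \<otimes> H\<close> here.\<close>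

lemma free_lift_functional_invariant:
  assumes X: "galois_map sA act X = (\<lambda>x. sA (l x) 1)" and f: "bilinear_map sA sH s f"
  shows "free_lift s (\<lambda>(c, g). sweedler s h (\<lambda>x y. f (act x c) (y * g))) X
    = s (\<epsilon> h) (free_lift s (\<lambda>(c, g). f c g) X)"
proof -
  note s = bilinear_target[OF f]
  define Y where "Y = free_lift free_scale (\<lambda>(c, g). free_lift free_scale
      (\<lambda>(x, y). gen (act x c, y * g)) (\<Delta> h)) X"
  have lift_Y: "free_lift t (\<lambda>(c, g). k c g) Y
      = free_lift t (\<lambda>(c, g). sweedler t h (\<lambda>x y. k (act x c) (y * g))) X"
    if t: "vector_space t" for t :: "'k \<Rightarrow> 'z::ab_group_add \<Rightarrow> 'z" and k
    unfolding Y_def by (simp add: free_lift_free_lift t case_prod_unfold sweedler_def)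
  have "galois_map sA act Y x = galois_map sA act (free_scale (\<epsilon> h) X) x" for x
  proof -
    have "galois_map sA act Y x = act h (galois_map sA act X x)"
      unfolding galois_map_apply lift_Y[OF vector_space_sA] linear_free_lift_apply[OF act_linear_right]
      by (simp add: case_prod_unfold act_mult act_product)
    also have "\<dots> = sA (\<epsilon> h) (galois_map sA act X x)"
      by (simp add: X linear_scale[OF act_linear_right] act_on_one mult.commute)
    also have "\<dots> = galois_map sA act (free_scale (\<epsilon> h) X) x"
      by (simp add: galois_map_apply linear_scale[OF linear_free_lift[OF vector_space_sA]])
    finally show ?thesis .
  qed
  then have "galois_map sA act Y = galois_map sA act (free_scale (\<epsilon> h) X)" by (rule ext)
  from galois_lift[OF this f] show ?thesis
    by (simp add: lift_Y s linear_scale[OF linear_free_lift[OF s]])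
qed

section \<open>Bijectivity of the antipode\<close>

text \<open>The identity \<open>(ha)b = \<Sum> h'(a S(h'')b)\<close>, solved for its inner factor.\<close>

lemma act_mult_via_antipode:
  "sweedler sA g (\<lambda>x y. act (S x) (act y a * b)) = a * act (S g) b"
proof -
  have id: "(\<lambda>b. b) \<in> module_endos sA act"
    by (simp add: module_endos_iff linear_identity[OF vector_space_sA])
  have "act y a * b = sweedler sA y (\<lambda>y' y''. act y' (a * act (S y'') b))" for y
    using fun_cong[OF conj_act_mult_endo[OF id, of y a], of b] by (simp add: conj_act_def)
  then have "sweedler sA g (\<lambda>x y. act (S x) (act y a * b))
    = sweedler sA g (\<lambda>x y. sweedler sA y (\<lambda>y' y''. act (S x) (act y' (a * act (S y'') b))))"
    by (simp add: linear_sweedler_apply[OF act_linear_right])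
  also have "\<dots> = sweedler sA g (\<lambda>x y. sweedler sA x (\<lambda>x' x''. act (S x') (act x'' (a * act (S y) b))))"
    by (rule sweedler_coassoc[symmetric]) (intro linear_intros vector_space_sH)+
  also have "\<dots> = sweedler sA g (\<lambda>x y. sA (\<epsilon> x) (a * act (S y) b))"
    using sweedler_antipode_left[OF act_linear_left]
    by (simp add: act_mult[symmetric]) (simp add: act_one)
  also have "\<dots> = a * act (S g) b"
    by (rule sweedler_counit_left) (intro linear_intros vector_space_sH)
  finally show ?thesis .
qed

text \<open>Let \<open>S g = 0\<close>.  For any functional \<open>\<xi>\<close> on \<open>H\<close> there are \<open>b\<^sub>u\<close> with \<open>\<Sum> (hu)b\<^sub>u = \<xi>(h)1\<close> for all \<open>h\<close>,
  obtained from the partition of unity: in matrix terms the Galois condition makes the matrix \<open>(hu)\<close>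
  over \<open>A\<close>, with \<open>h\<close> and \<open>u\<close> in bases of \<open>H\<close> and \<open>A\<close>, invertible on both sides.  Then
  \<open>act_mult_via_antipode\<close> gives \<open>0 = \<Sum> u S(g)b\<^sub>u = \<Sum> S(g')(\<xi>(g'')1) = \<xi>(g)1\<close>.\<close>

lemma inj_antipode: "inj S"
proof -
  obtain B :: "'a set" and l X where "finite B"
    and l: "\<And>x. (\<Sum>u\<in>B. sA (l u x) u) = x" and X: "\<And>u. galois_map sA act (X u) = (\<lambda>x. sA (l u x) 1)"
    by (rule galois_partition_of_unity) blast
  have "g = 0" if g: "S g = 0" for g
  proof (rule ccontr)
    assume "g \<noteq> 0"
    then obtain \<xi> where \<xi>: "Vector_Spaces.linear sH (*) \<xi>" "\<xi> g = 1"
      using linear_functional_extend[OF vector_space_sH, of "{g}" "\<lambda>_. 1"] by auto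
    define b where "b u = free_lift sA (\<lambda>(c, k). sA (\<xi> k) c) (X u)" for u
    have b: "(\<Sum>u\<in>B. act h u * b u) = sA (\<xi> h) 1" for h
    proof -
      have "bilinear_map sA sH sA (\<lambda>c k. sA (\<xi> k) c)"
        by (intro linear_intros vector_space_sA \<xi>)
      from free_lift_partition_of_unity[OF l X this, of h] show ?thesis
        unfolding b_def by (subst linear_free_lift_apply[of sA sA "\<lambda>z. _ * z"])
          (auto intro!: linear_intros vector_space_sA simp: case_prod_unfold A.scale_mult_right)
    qed
    have "0 = (\<Sum>u\<in>B. u * act (S g) (b u))"
      using linear_zero[OF act_linear_left] by (simp add: g)
    also have "\<dots> = (\<Sum>u\<in>B. sweedler sA g (\<lambda>x y. act (S x) (act y u * b u)))"
      by (simp add: act_mult_via_antipode)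
    also have "\<dots> = sweedler sA g (\<lambda>x y. \<Sum>u\<in>B. act (S x) (act y u * b u))"
      by (simp add: sweedler_def free_lift_def case_prod_unfold A.scale_sum_right)
        (rule sum.swap)
    also have "\<dots> = sweedler sA g (\<lambda>x y. sA (\<epsilon> x) (sA (\<xi> y) 1))"
      by (simp add: linear_sum[OF act_linear_right, symmetric] b linear_scale[OF act_linear_right]
          act_on_one counit_antipode mult.commute)
    also have "\<dots> = sA (\<xi> g) 1"
      by (rule sweedler_counit_left) (intro linear_intros vector_space_sA \<xi>)
    finally show False using \<xi>(2) by simp
  qed
  then show ?thesis
    using linear_diff[OF antipode_linear] by (metis injI right_minus_eq)
qed

lemma bij_antipode: "bij S"
proof -
  obtain C where C: "finite C" "span C = UNIV" using fin_dim_H by (auto simp: fin_dim_def)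
  obtain D where D: "D \<subseteq> C" "independent D" "C \<subseteq> span D"
    using maximal_independent_subset[of C] by blast
  then have "span D = UNIV" using C(2) span_mono[of C "span D"] by (auto simp: span_span)
  then interpret F: finite_dimensional_vector_space sH D
    by unfold_locales (use D C finite_subset in auto)
  show ?thesis using inj_antipode F.linear_inj_imp_surj[OF antipode_linear] by (simp add: bij_def)
qed

lemma antipode_inv_antipode: "S (inv S x) = x"
  using bij_antipode by (simp add: bij_is_surj surj_f_inv_f)

lemma linear_inv_antipode [linear_intros]:
  assumes "Vector_Spaces.linear s sH f" shows "Vector_Spaces.linear s sH (\<lambda>x. inv S (f x))"
proof -
  have "inv S (x + y) = inv S x + inv S y" for x y
    by (rule injD[OF inj_antipode]) (simp add: linear_add[OF antipode_linear] antipode_inv_antipode)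
  moreover have "inv S (sH c x) = sH c (inv S x)" for c x
    by (rule injD[OF inj_antipode]) (simp add: linear_scale[OF antipode_linear] antipode_inv_antipode)
  ultimately have "Vector_Spaces.linear sH sH (inv S)"
    by (simp add: Vector_Spaces.linear_iff vector_space_sH)
  from linear_comp[OF this assms] show ?thesis .
qed

text \<open>Apply \<open>S\<close>, which reverses products, to \<open>\<Sum> h'' S\<^sup>-\<^sup>1(h')\<close> and get the antipode identity
  \<open>\<Sum> h' S(h'') = \<epsilon>(h)\<close>; the next lemma is the mirror image.\<close>

lemma sweedler_inv_antipode_left:
  assumes "Vector_Spaces.linear sH s f"
  shows "sweedler s h (\<lambda>x y. f (y * inv S x)) = s (\<epsilon> h) (f 1)"
proof -
  have "S (sweedler sH h (\<lambda>x y. y * inv S x)) = sweedler sH h (\<lambda>x y. x * S y)"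
    by (simp add: linear_sweedler_apply[OF antipode_linear] antipode_mult antipode_inv_antipode)
  also have "\<dots> = S (sH (\<epsilon> h) 1)"
    using sweedler_antipode_right[OF linear_identity[OF vector_space_sH]]
    by (simp add: linear_scale[OF antipode_linear] antipode_one)
  finally have "sweedler sH h (\<lambda>x y. y * inv S x) = sH (\<epsilon> h) 1" by (rule injD[OF inj_antipode])
  then show ?thesis
    by (simp add: linear_sweedler_apply[OF assms, symmetric] linear_scale[OF assms])
qed

lemma sweedler_inv_antipode_right:
  assumes "Vector_Spaces.linear sH s f"
  shows "sweedler s h (\<lambda>x y. f (inv S y * x)) = s (\<epsilon> h) (f 1)"
proof -
  have "S (sweedler sH h (\<lambda>x y. inv S y * x)) = sweedler sH h (\<lambda>x y. S x * y)"
    by (simp add: linear_sweedler_apply[OF antipode_linear] antipode_mult antipode_inv_antipode)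
  also have "\<dots> = S (sH (\<epsilon> h) 1)"
    using sweedler_antipode_left[OF linear_identity[OF vector_space_sH]]
    by (simp add: linear_scale[OF antipode_linear] antipode_one)
  finally have "sweedler sH h (\<lambda>x y. inv S y * x) = sH (\<epsilon> h) 1" by (rule injD[OF inj_antipode])
  then show ?thesis
    by (simp add: linear_sweedler_apply[OF assms, symmetric] linear_scale[OF assms])
qed

section \<open>Generation of the endomorphism algebra\<close>

text \<open>Let \<open>r u = P\<^sub>u \<cdot> m\<close> be the result of letting \<open>P\<^sub>u \<in> A \<otimes> H\<close> act on the operator \<open>m\<close> by left
  multiplication and conjugation.  It is invariant since \<open>h P\<^sub>u = \<epsilon>(h) P\<^sub>u\<close>, and the partition of unity
  \<open>id = \<Sum> L\<^sub>u P\<^sub>u\<close> gives \<open>m = \<Sum> L\<^sub>u (r u)\<close>.\<close>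

lemma op_space_eq_span_endos:
  assumes V: "\<And>h v. v \<in> V \<Longrightarrow> ad h v \<in> V" and m: "m \<in> op_space V"
  shows "m \<in> Op.span {(\<lambda>b. a * r b) | a r. r \<in> op_space V \<inter> module_endos sA act}"
proof -
  note m_lin = op_space_linear[OF m]
  obtain B :: "'a set" and l X where "finite B"
    and l: "\<And>x. (\<Sum>u\<in>B. sA (l u x) u) = x" and X: "\<And>u. galois_map sA act (X u) = (\<lambda>x. sA (l u x) 1)"
    by (rule galois_partition_of_unity) blast
  have bil: "bilinear_map sA sH sA (\<lambda>c g. c * conj_act g m b)" for b
    by (intro linear_intros vector_space_sA vector_space_sH m_lin)
  define r where "r u = free_lift (fun_scale sA) (\<lambda>(c, g) b. c * conj_act g m b) (X u)" for u
  have r_apply: "r u b = free_lift sA (\<lambda>(c, g). c * conj_act g m b) (X u)" for u b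
    by (simp add: r_def free_lift_fun_scale[OF vector_space_sA] case_prod_unfold)
  have r_op: "r u \<in> op_space V" for u
    unfolding r_def
    by (rule subspace_free_lift[OF Op.vector_space_axioms subspace_op_space])
      (auto intro!: op_space_mult op_space_conj_act V m)
  have "r u \<in> module_endos sA act" for u
  proof (rule endo_if_conj_act_trivial[OF op_space_linear[OF r_op]])
    fix h b
    have "conj_act h (r u) b
      = free_lift sA (\<lambda>(c, g). sweedler sA h (\<lambda>x y. act x c * conj_act (y * g) m b)) (X u)"
      unfolding r_def linear_free_lift_apply[OF linear_conj_act]
      unfolding free_lift_fun_scale[OF vector_space_sA]
      by (simp add: case_prod_unfold conj_act_mult_op linear_conj_act_arg m_lin conj_act_mult)
    also have "\<dots> = sA (\<epsilon> h) (r u b)"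
      unfolding r_apply by (rule free_lift_functional_invariant[OF X bil])
    finally show "conj_act h (r u) b = sA (\<epsilon> h) (r u b)" .
  qed
  with r_op have r: "r u \<in> op_space V \<inter> module_endos sA act" for u by blast
  have "m b = (\<Sum>u\<in>B. u * r u b)" for b
  proof -
    have "(\<Sum>u\<in>B. u * r u b) = (\<Sum>u\<in>B. free_lift sA (\<lambda>(c, g). act 1 u * c * conj_act g m b) (X u))"
      unfolding r_apply
      by (subst linear_free_lift_apply[of sA sA "\<lambda>z. _ * z"])
        (auto intro!: linear_intros vector_space_sA sum.cong simp: case_prod_unfold mult.assoc act_one)
    also have "\<dots> = 1 * conj_act 1 m b" by (rule free_lift_partition_of_unity[OF l X bil])
    finally show ?thesis by (simp add: conj_act_one m_lin)
  qed
  then have "m = (\<Sum>u\<in>B. (\<lambda>b. u * r u b))" by (intro ext) (simp add: sum_fun_apply)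
  also have "\<dots> \<in> Op.span {(\<lambda>b. a * r b) | a r. r \<in> op_space V \<inter> module_endos sA act}"
    using r by (intro Op.span_sum Op.span_base) blast
  finally show ?thesis .
qed

text \<open>The product of two elements \<open>g\<close>, \<open>h\<close> acting as sums of operators \<open>L\<^sub>a r\<close> with \<open>r \<in> R\<close> acts as such a
  sum again: \<open>L\<^sub>a r h = L\<^sub>a h r\<close>, and \<open>h\<close> can be expanded in turn.  So all linear operators have this
  form.  The map \<open>\<Theta>\<close> is the action of the rank one operator \<open>l(-)1\<close> with \<open>l(1) = 1\<close> on operators; it
  sends \<open>L\<^sub>a r\<close> to \<open>l(a) r\<close>, so it maps every linear operator into \<open>R\<close> and fixes the \<open>H\<close>-linear ones.\<close>

lemma endos_generated_by_op_space:
  assumes V: "\<And>h v. v \<in> V \<Longrightarrow> ad h v \<in> V" and gen: "subalgebra sH (*) 1 hull V = UNIV"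
    and R: "subalgebra (fun_scale sA) (\<circ>) id R" "R \<subseteq> module_endos sA act"
      "op_space V \<inter> module_endos sA act \<subseteq> R"
  shows "R = module_endos sA act"
proof -
  let ?G = "{(\<lambda>b. a * r b) | a r. r \<in> R}"
  have R_sub: "Op.subspace R" and R_id: "id \<in> R" and R_comp: "\<And>r r'. r \<in> R \<Longrightarrow> r' \<in> R \<Longrightarrow> r \<circ> r' \<in> R"
    using R(1) by (auto simp: subalgebra_def)
  have G_base: "(\<lambda>b. a * r b) \<in> Op.span ?G" if "r \<in> R" for a r
    using that by (intro Op.span_base) blast
  have comp: "(\<lambda>x. a * G (r x)) \<in> Op.span ?G" if "G \<in> Op.span ?G" "r \<in> R" for a r G
  proof (rule linear_span_into[OF _ that(1), where f = "\<lambda>G x. a * G (r x)"])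
    show "Vector_Spaces.linear (fun_scale sA) (fun_scale sA) (\<lambda>G x. a * G (r x))"
      by (intro linear_into_funI Op.vector_space_axioms vector_space_sA linear_mult_right_A linear_eval)
    fix F assume "F \<in> ?G"
    then obtain b r' where "F = (\<lambda>x. b * r' x)" "r' \<in> R" by auto
    then show "(\<lambda>x. a * F (r x)) \<in> Op.span ?G"
      using G_base[OF R_comp[of r' r], of "a * b"] that(2) by (simp add: mult.assoc)
  qed simp
  have act_span: "act g \<in> Op.span ?G" for g
  proof -
    have "subalgebra sH (*) 1 {g. act g \<in> Op.span ?G}"
    proof -
      have 0: "act 0 \<in> Op.span ?G"
      proof -
        have "act 0 = 0" using linear_zero[OF act_linear_left] by auto
        then show ?thesis by (simp add: Op.span_zero)
      qed
      have 1: "act 1 \<in> Op.span ?G"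
      proof -
        have "act 1 = (\<lambda>b. 1 * id b)" by (auto simp: act_one)
        then show ?thesis using G_base[OF R_id, of 1] by simp
      qed
      have plus: "act (g + h) \<in> Op.span ?G" if "act g \<in> Op.span ?G" "act h \<in> Op.span ?G" for g h
      proof -
        have "act (g + h) = act g + act h" using linear_add[OF act_linear_left] by auto
        then show ?thesis using that by (simp add: Op.span_add)
      qed
      have scale: "act (sH c g) \<in> Op.span ?G" if "act g \<in> Op.span ?G" for c g
      proof -
        have "act (sH c g) = fun_scale sA c (act g)"
          using linear_scale[OF act_linear_left] by (auto simp: fun_scale_def)
        then show ?thesis using that by (simp add: Op.span_scale)
      qed
      have times: "act (g * h) \<in> Op.span ?G" if gh: "act g \<in> Op.span ?G" "act h \<in> Op.span ?G" for g h
      proof -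
        have "(\<lambda>x. act g (act h x)) \<in> Op.span ?G"
        proof (rule linear_span_into[OF _ gh(1), where f = "\<lambda>F x. F (act h x)"])
          show "Vector_Spaces.linear (fun_scale sA) (fun_scale sA) (\<lambda>F x. F (act h x) :: 'a)"
            by (intro linear_into_funI Op.vector_space_axioms vector_space_sA linear_eval)
          fix F assume "F \<in> ?G"
          then obtain a r where F: "F = (\<lambda>b. a * r b)" "r \<in> R" by auto
          then have "r (act h x) = act h (r x)" for x using R(2) by (auto simp: module_endos_iff)
          then show "(\<lambda>x. F (act h x)) \<in> Op.span ?G"
            using comp[OF gh(2) F(2), of a] by (simp add: F(1))
        qed simp
        moreover have "act (g * h) = (\<lambda>x. act g (act h x))" by (auto simp: act_mult)
        ultimately show ?thesis by simp
      qed
      show ?thesis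
        unfolding subalgebra_def subspace_def mem_Collect_eq
        using 0 1 plus scale times by blast
    qed
    moreover have "V \<subseteq> {g. act g \<in> Op.span ?G}"
    proof
      fix v assume v: "v \<in> V"
      have "act v \<in> op_space V" using op_space_base[OF v, of 1] by simp
      from op_space_eq_span_endos[OF V this]
      have "act v \<in> Op.span {(\<lambda>b. a * r b) | a r. r \<in> op_space V \<inter> module_endos sA act}" .
      moreover have "{(\<lambda>b. a * r b) | a r. r \<in> op_space V \<inter> module_endos sA act} \<subseteq> ?G"
      proof
        fix F assume "F \<in> {(\<lambda>b. a * r b) | a r. r \<in> op_space V \<inter> module_endos sA act}"
        then obtain a r where "F = (\<lambda>b. a * r b)" "r \<in> R" using R(3) by auto
        then show "F \<in> ?G" by blast
      qed
      ultimately have "act v \<in> Op.span ?G" using Op.span_mono by blast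
      then show "v \<in> {g. act g \<in> Op.span ?G}" by simp
    qed
    ultimately have "subalgebra sH (*) 1 hull V \<subseteq> {g. act g \<in> Op.span ?G}" by (intro hull_minimal)
    then show ?thesis using gen by auto
  qed
  have lin_span: "F \<in> Op.span ?G" if F: "Vector_Spaces.linear sA sA F" for F
  proof -
    obtain X where X: "galois_map sA act X = F" using galois_surj[OF F] .
    show ?thesis unfolding X[symmetric] galois_map_def
      by (intro subspace_free_lift[OF Op.vector_space_axioms])
        (use comp[OF act_span R_id] in auto)
  qed
  obtain l where l: "Vector_Spaces.linear sA (*) l" "l 1 = 1"
    using linear_functional_extend[OF vector_space_sA, of "{1}" "\<lambda>_. 1"] by auto
  have "Vector_Spaces.linear sA sA (\<lambda>x. sA (l x) 1)" by (intro linear_intros vector_space_sA l)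
  then obtain X where X: "galois_map sA act X = (\<lambda>x. sA (l x) 1)" by (rule galois_surj)
  define \<Theta> where "\<Theta> F = (\<lambda>x. free_lift sA (\<lambda>(b, g). b * conj_act g F x) X)" for F
  have conj_lin: "Vector_Spaces.linear (fun_scale sA) sA (\<lambda>F. conj_act g F x)" for g x
    by (rule linear_comp[OF linear_eval[OF vector_space_sA] linear_conj_act])
  have \<Theta>_lin: "Vector_Spaces.linear (fun_scale sA) (fun_scale sA) \<Theta>"
    unfolding \<Theta>_def
    by (intro linear_into_funI Op.vector_space_axioms vector_space_sA linear_free_lift_pair_fun
        linear_mult_right_A conj_lin)
  have \<Theta>_mult: "\<Theta> (\<lambda>b. a * r b) = fun_scale sA (l a) r" if "r \<in> module_endos sA act" for a r
  proof
    fix x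
    have "\<Theta> (\<lambda>b. a * r b) x = galois_map sA act X a * r x"
      unfolding \<Theta>_def galois_map_apply
      by (subst linear_free_lift_apply[of sA sA "\<lambda>z. z * _"])
        (auto intro!: linear_intros vector_space_sA
          simp: conj_act_mult_endo[OF that] case_prod_unfold mult.assoc)
    then show "\<Theta> (\<lambda>b. a * r b) x = fun_scale sA (l a) r x"
      by (simp add: X fun_scale_def A.scale_mult_left)
  qed
  have "F \<in> R" if F: "F \<in> module_endos sA act" for F
  proof -
    have "\<Theta> F \<in> R"
    proof (rule linear_span_into[OF \<Theta>_lin _ R_sub])
      show "F \<in> Op.span ?G" using F by (intro lin_span) (simp add: module_endos_iff)
      fix G assume "G \<in> ?G"
      then obtain a r where "G = (\<lambda>b. a * r b)" "r \<in> R" by auto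
      then show "\<Theta> G \<in> R" using \<Theta>_mult R(2) R_sub by (auto simp: Op.subspace_scale)
    qed
    moreover have "\<Theta> F = F" using \<Theta>_mult[OF F, of 1] l(2) by (simp add: fun_scale_def)
    ultimately show ?thesis by simp
  qed
  with R(2) show ?thesis by blast
qed

end

section \<open>Equivariant maps on the dual and the operators \<open>\<Psi>\<^sub>\<tau>\<close>\<close>

lemma dual_bases_members:
  assumes "vector_space s" "dual_bases s V I e e'"
  shows "module.subspace s V" "finite I" "\<And>i. i \<in> I \<Longrightarrow> e i \<in> V" "\<And>i. i \<in> I \<Longrightarrow> e' i \<in> dual_space s V"
proof -
  interpret vector_space s by fact
  show "module.subspace s V" "finite I" "\<And>i. i \<in> I \<Longrightarrow> e i \<in> V" "\<And>i. i \<in> I \<Longrightarrow> e' i \<in> dual_space s V"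
    using assms(2) unfolding dual_bases_def by (auto simp: span_base)
qed

text \<open>Extending to the whole space makes the linearity rules applicable without membership side conditions.\<close>

lemma dual_space_extend:
  assumes s: "vector_space s" and db: "dual_bases s V I e e'" and \<xi>: "\<xi> \<in> dual_space s V"
  obtains f where "Vector_Spaces.linear s (*) f" "\<And>v. v \<in> V \<Longrightarrow> f v = \<xi> v"
proof -
  interpret vector_space s by (rule s)
  have B: "independent (e ` I)" "span (e ` I) = V" using db by (auto simp: dual_bases_def)
  obtain f where f: "Vector_Spaces.linear s (*) f" "\<And>b. b \<in> e ` I \<Longrightarrow> f b = \<xi> b"
    using linear_functional_extend[OF s B(1)] by metis
  have \<xi>0: "\<xi> 0 = 0"
  proof -
    have "0 \<in> V" using B(2) span_zero by blast
    then have "\<xi> (s 0 0) = 0 * \<xi> 0" using \<xi> unfolding dual_space_def by blast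
    then show ?thesis by simp
  qed
  have "subspace {v \<in> V. f v = \<xi> v}"
    using \<xi> B(2) subspace_span[of "e ` I"] \<xi>0
    by (auto simp: subspace_def dual_space_def linear_add[OF f(1)] linear_scale[OF f(1)] linear_zero[OF f(1)])
  then have "V \<subseteq> {v \<in> V. f v = \<xi> v}"
    using span_minimal[of "e ` I" "{v \<in> V. f v = \<xi> v}"] f(2) B(2) span_base by blast
  with f(1) that show thesis by blast
qed

lemma dual_bases_expansion:
  assumes s: "vector_space s" and db: "dual_bases s V I e e'" and v: "v \<in> V"
  shows "(\<Sum>i\<in>I. s (e' i v) (e i)) = v"
proof -
  interpret vector_space s by (rule s)
  note m = dual_bases_members[OF s db]
  have "\<exists>f. Vector_Spaces.linear s (*) f \<and> (\<forall>v\<in>V. f v = e' i v)" if "i \<in> I" for i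
    using dual_space_extend[OF s db m(4)[OF that]] by metis
  then obtain f where f: "\<And>i. i \<in> I \<Longrightarrow> Vector_Spaces.linear s (*) (f i)"
      "\<And>i v. i \<in> I \<Longrightarrow> v \<in> V \<Longrightarrow> f i v = e' i v" by metis
  have sum_lin: "Vector_Spaces.linear s s (\<lambda>v. \<Sum>i\<in>I. s (f i v) (e i))"
    by (rule linear_sum_fun[OF s s]) (rule linear_scaling_left[OF s f(1)])
  then have lin: "Vector_Spaces.linear s s (\<lambda>v. (\<Sum>i\<in>I. s (f i v) (e i)) - v)"
    by (simp add: Vector_Spaces.linear_iff algebra_simps scale_right_diff_distrib)
  have "(\<Sum>i\<in>I. s (f i v) (e i)) - v = 0"
  proof (rule linear_zero_on_span[OF lin])
    show "v \<in> span (e ` I)" using db v by (auto simp: dual_bases_def)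
    fix b assume "b \<in> e ` I"
    then obtain j where j: "j \<in> I" "b = e j" by auto
    have "(\<Sum>i\<in>I. s (f i b) (e i)) = (\<Sum>i\<in>I. if i = j then e i else 0)"
      using db j by (intro sum.cong) (auto simp: f(2) m(3) dual_bases_def)
    then show "(\<Sum>i\<in>I. s (f i b) (e i)) - b = 0" using j m(2) by simp
  qed
  then show ?thesis using v by (simp add: f(2))
qed

lemma module_homs_sum:
  assumes "vector_space sW" "module.subspace sW W" "vector_space sA"
    and f: "f \<in> module_homs W sW actW sA actA" and w: "\<And>i. i \<in> B \<Longrightarrow> w i \<in> W"
  shows "f (\<Sum>i\<in>B. sW (c i) (w i)) = (\<Sum>i\<in>B. sA (c i) (f (w i)))"
proof -
  interpret W: vector_space sW by fact
  interpret A: vector_space sA by fact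
  have add: "f (x + y) = f x + f y" and scale: "f (sW a x) = sA a (f x)" if "x \<in> W" "y \<in> W" for x y a
    using f that by (auto simp: module_homs_def)
  have 0: "0 \<in> W" using assms(2) by (rule W.subspace_0)
  show ?thesis using w
  proof (induction B rule: infinite_finite_induct)
    case (insert i B)
    have "(\<Sum>i\<in>B. sW (c i) (w i)) \<in> W" "sW (c i) (w i) \<in> W"
      using insert.prems assms(2) by (auto intro!: W.subspace_sum W.subspace_scale)
    then show ?case using insert by (simp add: add scale)
  qed (use scale[OF 0 0, of 0] in simp_all)
qed

lemma subspace_dual_space:
  assumes "vector_space s" "module.subspace s V"
  shows "module.subspace (fun_scale (*)) (dual_space s V)"
proof -
  interpret vector_space s by fact
  interpret f: vector_space "fun_scale (*) :: 'a \<Rightarrow> ('b \<Rightarrow> 'a) \<Rightarrow> _"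
    by (rule vector_space_fun_scale[OF vector_space_mult])
  show ?thesis by (auto simp: f.subspace_def dual_space_def fun_scale_def algebra_simps)
qed

context fin_dim_galois_module_algebra
begin

interpretation Op: vector_space "fun_scale sA :: 'k \<Rightarrow> ('a \<Rightarrow> 'a) \<Rightarrow> _"
  by (rule vector_space_fun_scale[OF vector_space_sA])

lemma right_dual_action_expansion:
  assumes db: "dual_bases sH V I e e'" and V: "\<And>h v. v \<in> V \<Longrightarrow> ad h v \<in> V"
    and \<xi>: "\<xi> \<in> dual_space sH V"
  shows "right_dual_action S V ad h \<xi> = (\<Sum>j\<in>I. fun_scale (*) (\<xi> (ad (inv S h) (e j))) (e' j))"
proof
  fix v
  note m = dual_bases_members[OF vector_space_sH db]
  obtain f where f: "Vector_Spaces.linear sH (*) f" "\<And>v. v \<in> V \<Longrightarrow> f v = \<xi> v"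
    using dual_space_extend[OF vector_space_sH db \<xi>] by metis
  have R: "(\<Sum>j\<in>I. fun_scale (*) (\<xi> (ad (inv S h) (e j))) (e' j)) v
      = (\<Sum>j\<in>I. \<xi> (ad (inv S h) (e j)) * e' j v)"
    by (simp add: sum_fun_apply) (simp add: fun_scale_def)
  show "right_dual_action S V ad h \<xi> v = (\<Sum>j\<in>I. fun_scale (*) (\<xi> (ad (inv S h) (e j))) (e' j)) v"
  proof (cases "v \<in> V")
    case True
    have lin: "Vector_Spaces.linear sH (*) (\<lambda>w. f (ad (inv S h) w))"
      by (rule linear_comp[OF f(1)]) (intro linear_intros vector_space_sH)
    have "\<xi> (ad (inv S h) v) = f (ad (inv S h) (\<Sum>j\<in>I. sH (e' j v) (e j)))"
      using True V by (simp add: f(2) dual_bases_expansion[OF vector_space_sH db])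
    also have "\<dots> = (\<Sum>j\<in>I. \<xi> (ad (inv S h) (e j)) * e' j v)"
      using m(3) V by (simp add: linear_sum[OF lin] linear_scale[OF lin] f(2) mult.commute)
    finally show ?thesis using True unfolding R by (simp add: right_dual_action_def)
  next
    case False
    then have "e' j v = 0" if "j \<in> I" for j using m(4)[OF that] by (auto simp: dual_space_def)
    with False show ?thesis unfolding R by (simp add: right_dual_action_def)
  qed
qed

lemma Psi_in_op_space:
  assumes "dual_bases sH V I e e'" shows "Psi act I e e' \<tau> \<in> op_space V"
proof -
  have "Psi act I e e' \<tau> = (\<Sum>i\<in>I. (\<lambda>b. \<tau> (e' i) * act (e i) b))"
    by (auto simp: Psi_def sum_fun_apply)
  also have "\<dots> \<in> op_space V"
    by (intro Op.subspace_sum subspace_op_space op_space_base dual_bases_members[OF vector_space_sH assms])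
  finally show ?thesis .
qed

text \<open>In \<open>h \<cdot> \<Psi>\<^sub>\<tau> = \<Sum> L(h'\<tau>(e\<^sub>i\<^sup>*)) (h'' \<triangleright> e\<^sub>i)\<close> the action of \<open>h'\<close> moves into the argument of \<open>\<tau>\<close>, and
  expanding it in the dual basis moves it on to \<open>e\<^sub>i\<close> as \<open>S\<^sup>-\<^sup>1(h')\<close>, where \<open>\<Sum> h'' S\<^sup>-\<^sup>1(h') = \<epsilon>(h)\<close>.
  Here \<open>L(a)\<close> is left multiplication by \<open>a\<close>, and \<open>\<triangleright>\<close> is the adjoint action.\<close>

lemma Psi_endo:
  assumes db: "dual_bases sH V I e e'" and V: "\<And>h v. v \<in> V \<Longrightarrow> ad h v \<in> V"
    and \<tau>: "\<tau> \<in> D_right_dual sH \<Delta> S sA act V"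
  shows "Psi act I e e' \<tau> \<in> module_endos sA act"
proof (rule endo_if_conj_act_trivial[OF op_space_linear[OF Psi_in_op_space[OF db]]])
  fix h b
  note m = dual_bases_members[OF vector_space_sH db]
  note \<tau>' = \<tau>[unfolded D_right_dual_def]
  define t where "t i = \<tau> (e' i)" for i
  have act_t: "act x (t i) = (\<Sum>j\<in>I. sA (e' i (ad (inv S x) (e j))) (t j))" if "i \<in> I" for x i
  proof -
    have "act x (t i) = \<tau> (right_dual_action S V ad x (e' i))"
      using \<tau>' m(4)[OF that] unfolding module_homs_def t_def by simp
    also have "\<dots> = (\<Sum>j\<in>I. sA (e' i (ad (inv S x) (e j))) (t j))"
      by (subst right_dual_action_expansion[OF db V m(4)[OF that]], assumption, unfold t_def)
        (rule module_homs_sum[OF vector_space_fun_scale[OF vector_space_mult]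
            subspace_dual_space[OF vector_space_sH m(1)] vector_space_sA \<tau>' m(4)])
    finally show ?thesis .
  qed
  have expand: "(\<Sum>i\<in>I. act x (t i) * act (ad y (e i)) b)
      = (\<Sum>j\<in>I. t j * act (ad (y * inv S x) (e j)) b)" for x y
  proof -
    have lin: "Vector_Spaces.linear sH sA (\<lambda>v. act (ad y v) b)" by (intro linear_intros vector_space_sH)
    have "(\<Sum>i\<in>I. act x (t i) * act (ad y (e i)) b)
      = (\<Sum>i\<in>I. \<Sum>j\<in>I. t j * sA (e' i (ad (inv S x) (e j))) (act (ad y (e i)) b))"
      by (intro sum.cong refl)
        (simp add: act_t sum_distrib_right A.scale_mult_left A.scale_mult_right)
    also have "\<dots> = (\<Sum>j\<in>I. t j * act (ad y (\<Sum>i\<in>I. sH (e' i (ad (inv S x) (e j))) (e i))) b)"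
      by (subst sum.swap) (simp add: linear_sum[OF lin] linear_scale[OF lin] sum_distrib_left)
    also have "\<dots> = (\<Sum>j\<in>I. t j * act (ad (y * inv S x) (e j)) b)"
      using m(3) V by (simp add: dual_bases_expansion[OF vector_space_sH db] ad_mult)
    finally show ?thesis .
  qed
  have Psi_sum: "Psi act I e e' \<tau> = (\<Sum>i\<in>I. (\<lambda>b. t i * act (e i) b))"
    by (auto simp: Psi_def sum_fun_apply t_def)
  have "conj_act h (Psi act I e e' \<tau>) b = (\<Sum>i\<in>I. sweedler sA h (\<lambda>x y. act x (t i) * act (ad y (e i)) b))"
    unfolding Psi_sum linear_sum[OF linear_conj_act]
    by (simp add: sum_fun_apply conj_act_mult_op act_linear_right conj_act_act)
  also have "\<dots> = (\<Sum>j\<in>I. sweedler sA h (\<lambda>x y. t j * act (ad (y * inv S x) (e j)) b))"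
    unfolding sweedler_sum[OF vector_space_sA, symmetric] expand ..
  also have "\<dots> = (\<Sum>j\<in>I. sA (\<epsilon> h) (t j * act (ad 1 (e j)) b))"
    by (intro sum.cong refl sweedler_inv_antipode_left linear_intros vector_space_sH)
  also have "\<dots> = sA (\<epsilon> h) (Psi act I e e' \<tau> b)"
    by (simp add: ad_one Psi_def t_def A.scale_sum_right)
  finally show "conj_act h (Psi act I e e' \<tau>) b = sA (\<epsilon> h) (Psi act I e e' \<tau> b)" .
qed

lemma op_space_basis_form:
  assumes db: "dual_bases sH V I e e'" and F: "F \<in> op_space V"
  obtains a where "F = (\<lambda>b. \<Sum>i\<in>I. a i * act (e i) b)"
proof -
  let ?T = "{F. \<exists>a. F = (\<lambda>b. \<Sum>i\<in>I. a i * act (e i) b)}"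
  have "Op.subspace ?T"
    unfolding Op.subspace_def
  proof (intro conjI ballI allI)
    have "(0 :: 'a \<Rightarrow> 'a) = (\<lambda>b. \<Sum>i\<in>I. 0 * act (e i) b)" by auto
    then show "0 \<in> ?T" by (intro CollectI exI[of _ "\<lambda>_. 0"])
  next
    fix F G assume "F \<in> ?T" "G \<in> ?T"
    then obtain a c where "F = (\<lambda>b. \<Sum>i\<in>I. a i * act (e i) b)" "G = (\<lambda>b. \<Sum>i\<in>I. c i * act (e i) b)" by auto
    then have "F + G = (\<lambda>b. \<Sum>i\<in>I. (a i + c i) * act (e i) b)"
      by (auto simp: distrib_right sum.distrib)
    then show "F + G \<in> ?T" by (intro CollectI exI)
  next
    fix k F assume "F \<in> ?T"
    then obtain a where "F = (\<lambda>b. \<Sum>i\<in>I. a i * act (e i) b)" by auto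
    then have "fun_scale sA k F = (\<lambda>b. \<Sum>i\<in>I. sA k (a i) * act (e i) b)"
      by (auto simp: fun_scale_def A.scale_sum_right A.scale_mult_left)
    then show "fun_scale sA k F \<in> ?T" by (intro CollectI exI)
  qed
  moreover have "{(\<lambda>b. a * act v b) | a v. v \<in> V} \<subseteq> ?T"
  proof
    fix G assume "G \<in> {(\<lambda>b. a * act v b) | a v. v \<in> V}"
    then obtain a v where G: "G = (\<lambda>b. a * act v b)" "v \<in> V" by auto
    have "act v b = (\<Sum>i\<in>I. sA (e' i v) (act (e i) b))" for b
      using linear_sum[OF act_linear_left[of b], of "\<lambda>i. sH (e' i v) (e i)" I]
      by (simp add: dual_bases_expansion[OF vector_space_sH db G(2)] linear_scale[OF act_linear_left])
    then have "G = (\<lambda>b. \<Sum>i\<in>I. sA (e' i v) a * act (e i) b)"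
      by (auto simp: G(1) sum_distrib_left A.scale_mult_left A.scale_mult_right)
    then show "G \<in> ?T" by (intro CollectI exI)
  qed
  ultimately have "op_space V \<subseteq> ?T" unfolding op_space_def by (intro Op.span_minimal)
  with F that show thesis by blast
qed

text \<open>An \<open>H\<close>-linear operator is invariant under conjugation, so its tensor \<open>\<Sum> a\<^sub>i \<otimes> e\<^sub>i\<close> is invariant under
  the diagonal action; the functional \<open>\<zeta>\<close> is applied to the second factor.\<close>

lemma endo_coefficients_invariant:
  assumes F: "F \<in> module_endos sA act" and Fa: "F = (\<lambda>b. \<Sum>i\<in>I. a i * act (e i) b)"
    and \<zeta>: "Vector_Spaces.linear sH (*) \<zeta>"
  shows "(\<Sum>i\<in>I. sweedler sA h (\<lambda>x y. sA (\<zeta> (ad y (e i))) (act x (a i))))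
    = sA (\<epsilon> h) (\<Sum>i\<in>I. sA (\<zeta> (e i)) (a i))"
proof -
  define Y where "Y = (\<Sum>i\<in>I. free_lift free_scale (\<lambda>(x, y). gen (act x (a i), ad y (e i))) (\<Delta> h))"
  define Z where "Z = free_scale (\<epsilon> h) (\<Sum>i\<in>I. gen (a i, e i))"
  have lift_Y: "free_lift sA k Y = (\<Sum>i\<in>I. sweedler sA h (\<lambda>x y. k (act x (a i), ad y (e i))))" for k
    unfolding Y_def linear_sum[OF linear_free_lift[OF vector_space_sA]]
    by (simp add: free_lift_free_lift vector_space_sA case_prod_unfold sweedler_def)
  have lift_Z: "free_lift sA k Z = sA (\<epsilon> h) (\<Sum>i\<in>I. k (a i, e i))" for k
    unfolding Z_def linear_scale[OF linear_free_lift[OF vector_space_sA]]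
      linear_sum[OF linear_free_lift[OF vector_space_sA]] by (simp add: vector_space_sA)
  have "galois_map sA act Y b = galois_map sA act Z b" for b
  proof -
    have "F = (\<Sum>i\<in>I. (\<lambda>b. a i * act (e i) b))" by (auto simp: Fa sum_fun_apply)
    then have "conj_act h F b = (\<Sum>i\<in>I. sweedler sA h (\<lambda>x y. act x (a i) * act (ad y (e i)) b))"
      by (simp add: linear_sum[OF linear_conj_act] sum_fun_apply conj_act_mult_op act_linear_right conj_act_act)
    then show ?thesis
      using conj_act_endo[OF F, of h b] by (simp add: galois_map_apply lift_Y lift_Z Fa)
  qed
  then have "galois_map sA act Y = galois_map sA act Z" by (rule ext)
  moreover have "bilinear_map sA sH sA (\<lambda>c g. sA (\<zeta> g) c)" by (intro linear_intros vector_space_sA \<zeta>)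
  ultimately show ?thesis using galois_lift[of Y Z sA "\<lambda>c g. sA (\<zeta> g) c"] by (simp add: lift_Y lift_Z)
qed

text \<open>For \<open>F = \<Sum> L(a\<^sub>i) e\<^sub>i\<close> put \<open>\<tau>(\<xi>) = \<Sum> \<xi>(e\<^sub>i) a\<^sub>i\<close>, where \<open>L(a)\<close> is left multiplication by \<open>a\<close>.  Invariance of
  \<open>\<Sum> a\<^sub>i \<otimes> e\<^sub>i\<close>, paired with the functional \<open>\<xi>(S\<^sup>-\<^sup>1(h'') \<triangleright> -)\<close>, makes \<open>\<tau>\<close> equivariant because
  \<open>\<Sum> S\<^sup>-\<^sup>1(h'') h' = \<epsilon>(h)\<close>.\<close>

lemma op_space_endo_is_Psi:
  assumes db: "dual_bases sH V I e e'" and V: "\<And>h v. v \<in> V \<Longrightarrow> ad h v \<in> V"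
    and F: "F \<in> op_space V" "F \<in> module_endos sA act"
  obtains \<tau> where "\<tau> \<in> D_right_dual sH \<Delta> S sA act V" "F = Psi act I e e' \<tau>"
proof -
  note m = dual_bases_members[OF vector_space_sH db]
  obtain a where a: "F = (\<lambda>b. \<Sum>i\<in>I. a i * act (e i) b)" using op_space_basis_form[OF db F(1)] .
  define \<tau> where "\<tau> \<xi> = (\<Sum>i\<in>I. sA (\<xi> (e i)) (a i))" for \<xi> :: "'h \<Rightarrow> 'k"
  have equivariant: "\<tau> (right_dual_action S V ad h \<xi>) = act h (\<tau> \<xi>)" if \<xi>: "\<xi> \<in> dual_space sH V" for h \<xi>
  proof -
    obtain f where f: "Vector_Spaces.linear sH (*) f" "\<And>v. v \<in> V \<Longrightarrow> f v = \<xi> v"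
      using dual_space_extend[OF vector_space_sH db \<xi>] by metis
    have f_lin: "Vector_Spaces.linear sH (*) (\<lambda>z. f (ad z v))" "Vector_Spaces.linear sH (*) (\<lambda>v. f (ad z v))"
      "Vector_Spaces.linear sH (*) (\<lambda>z. f (ad (inv S z) v))" for v z
      by (rule linear_comp[OF f(1)], intro linear_intros vector_space_sH)+
    have "\<tau> (right_dual_action S V ad h \<xi>) = (\<Sum>i\<in>I. sA (f (ad (inv S h) (e i))) (a i))"
      using m(3) V by (simp add: \<tau>_def right_dual_action_def f(2))
    also have "\<dots> = sweedler sA h (\<lambda>w z. sA (\<epsilon> w) (\<Sum>i\<in>I. sA (f (ad (inv S z) (e i))) (a i)))"
      by (rule sweedler_counit_left[symmetric]) (intro linear_intros vector_space_sA vector_space_sH f_lin)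
    also have "\<dots> = sweedler sA h (\<lambda>w z. \<Sum>i\<in>I. sweedler sA w (\<lambda>x y.
        sA (f (ad (inv S z) (ad y (e i)))) (act x (a i))))"
      by (simp only: endo_coefficients_invariant[OF F(2) a f_lin(2)])
    also have "\<dots> = (\<Sum>i\<in>I. sweedler sA h (\<lambda>w z. sweedler sA w (\<lambda>x y.
        sA (f (ad (inv S z * y) (e i))) (act x (a i)))))"
      by (simp add: sweedler_sum[OF vector_space_sA] ad_mult)
    also have "\<dots> = (\<Sum>i\<in>I. sweedler sA h (\<lambda>x w. sweedler sA w (\<lambda>y z.
        sA (f (ad (inv S z * y) (e i))) (act x (a i)))))"
      by (intro sum.cong refl sweedler_coassoc linear_intros vector_space_sA vector_space_sH
          linear_comp[OF f_lin(1)])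
    also have "\<dots> = (\<Sum>i\<in>I. sweedler sA h (\<lambda>x w. sA (\<epsilon> w) (sA (f (e i)) (act x (a i)))))"
    proof -
      have "sweedler sA w (\<lambda>y z. sA (f (ad (inv S z * y) (e i))) (act x (a i)))
          = sA (\<epsilon> w) (sA (f (ad 1 (e i))) (act x (a i)))" for w x i
        by (rule sweedler_inv_antipode_right) (intro linear_intros vector_space_sA f_lin)
      then show ?thesis by (simp only: ad_one)
    qed
    also have "\<dots> = (\<Sum>i\<in>I. sA (f (e i)) (act h (a i)))"
      by (intro sum.cong refl sweedler_counit_right linear_intros vector_space_sH)
    also have "\<dots> = act h (\<tau> \<xi>)"
      using m(3) by (simp add: \<tau>_def f(2) linear_sum[OF act_linear_right] linear_scale[OF act_linear_right])
    finally show ?thesis .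
  qed
  have "\<tau> \<in> D_right_dual sH \<Delta> S sA act V"
    unfolding D_right_dual_def module_homs_def
    using equivariant
    by (auto simp: \<tau>_def fun_scale_def A.scale_left_distrib sum.distrib A.scale_sum_right)
  moreover have "F = Psi act I e e' \<tau>"
  proof -
    have "\<tau> (e' j) = a j" if "j \<in> I" for j
    proof -
      have "\<tau> (e' j) = (\<Sum>i\<in>I. if i = j then a i else 0)"
        unfolding \<tau>_def using db that by (intro sum.cong) (auto simp: dual_bases_def)
      then show ?thesis using that m(2) by simp
    qed
    then show ?thesis by (auto simp: a Psi_def)
  qed
  ultimately show thesis by (rule that)
qed

lemma endos_subalgebra: "subalgebra (fun_scale sA) (\<circ>) id (module_endos sA act)"
proof -
  have "Op.subspace (module_endos sA act)"
    unfolding Op.subspace_def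
    by (auto simp: module_endos_def module_homs_def fun_scale_def linear_zero[OF act_linear_right]
        linear_add[OF act_linear_right] linear_scale[OF act_linear_right] A.scale_right_distrib
        algebra_simps)
  moreover have "id \<in> module_endos sA act" by (simp add: module_endos_def module_homs_def)
  moreover have "F \<circ> G \<in> module_endos sA act"
    if "F \<in> module_endos sA act" "G \<in> module_endos sA act" for F G
    using that by (simp add: module_endos_def module_homs_def)
  ultimately show ?thesis by (simp add: subalgebra_def)
qed

end

theorem proposition4p4:
  fixes sH :: "'k::field \<Rightarrow> 'h::ring_1 \<Rightarrow> 'h"
    and \<Delta> :: "'h \<Rightarrow> ('h \<times> 'h \<Rightarrow>\<^sub>0 'k)"
    and \<epsilon> :: "'h \<Rightarrow> 'k"
    and S :: "'h \<Rightarrow> 'h"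
    and sA :: "'k \<Rightarrow> 'a::ring_1 \<Rightarrow> 'a"
    and act :: "'h \<Rightarrow> 'a \<Rightarrow> 'a"
    and V :: "'h set"
    and I :: "'i set"
    and e :: "'i \<Rightarrow> 'h"
    and e' :: "'i \<Rightarrow> 'h \<Rightarrow> 'k"
  assumes "fin_dim_hopf_algebra sH \<Delta> \<epsilon> S"
    and "galois_module_algebra sH \<Delta> \<epsilon> S sA act"
    and "module.subspace sH V"
    and "\<And>h v. v \<in> V \<Longrightarrow> adjoint_action sH \<Delta> S h v \<in> V"
    and "subalgebra sH (*) 1 hull V = UNIV"
    and "dual_bases sH V I e e'"
  shows "subalgebra (fun_scale sA) (\<circ>) id hull {Psi act I e e' \<tau> | \<tau>. \<tau> \<in> D_right_dual sH \<Delta> S sA act V}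
         = module_endos sA act"
proof -
  interpret fin_dim_galois_module_algebra sH \<Delta> \<epsilon> S sA act
    by (intro fin_dim_galois_module_algebra.intro fin_dim_galois_module_algebra_axioms.intro assms(2)
        fin_dim_hopf_algebra.finite_dimensional[OF assms(1)])
  let ?P = "{Psi act I e e' \<tau> | \<tau>. \<tau> \<in> D_right_dual sH \<Delta> S sA act V}"
  have P: "?P \<subseteq> module_endos sA act" using Psi_endo[OF assms(6,4)] by blast
  show ?thesis
  proof (rule endos_generated_by_op_space[OF assms(4,5)])
    show "subalgebra (fun_scale sA) (\<circ>) id (subalgebra (fun_scale sA) (\<circ>) id hull ?P)"
      by (rule subalgebra_hull[OF vector_space_fun_scale[OF vector_space_sA]])
    show "subalgebra (fun_scale sA) (\<circ>) id hull ?P \<subseteq> module_endos sA act"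
      by (rule hull_minimal[where S = "subalgebra (fun_scale sA) (\<circ>) id", OF P endos_subalgebra])
    show "op_space V \<inter> module_endos sA act \<subseteq> subalgebra (fun_scale sA) (\<circ>) id hull ?P"
      using op_space_endo_is_Psi[OF assms(6,4)] hull_subset[of ?P] by blast
  qed
qed

end
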